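(* Consider any infinite sequence of rational interval forecasts and outcomes $\upsilon=(\iota,\omega)\in(\mathcal{I}_r\times\{0,1\})^{\mathbb{N}}$ and any recursive selection function $S\colon(\mathcal{I}_r\times\{0,1\})^*\times\mathcal{I}_r\to\{0,1\}$ such that $\sum_{k=0}^{\infty}S(\upsilon_{1:k},\iota_{k+1})=\infty$. If $\upsilon$ is game-random, then $$\liminf_{n\to\infty}\frac{\sum_{k=0}^{n-1}S(\upsilon_{1:k},\iota_{k+1})[\omega_{k+1}-\min\iota_{k+1}]}{\sum_{k=0}^{n-1}S(\upsilon_{1:k},\iota_{k+1})}\geq0$$ and $$\limsup_{n\to\infty}\frac{\sum_{k=0}^{n-1}S(\upsilon_{1:k},\iota_{k+1})[\omega_{k+1}-\max\iota_{k+1}]}{\sum_{k=0}^{n-1}S(\upsilon_{1:k},\iota_{k+1})}\leq0.$$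
   Context: Let $\mathcal{X}=\{0,1\}$, $\mathbb{N}=\{1,2,\dots\}$ and $\mathbb{N}_0=\mathbb{N}\cup\{0\}$. An interval forecast is a non-empty closed interval $I\subseteq[0,1]$ (possibly a single point); $\mathcal{I}_r$ is the set of all interval forecasts with rational endpoints. For an interval forecast $I$ and $f\colon\mathcal{X}\to\mathbb{R}$, the upper expectation is $\overline{E}_I(f)=\max_{p\in I}[pf(1)+(1-p)f(0)]$. Prequential situations are the elements $v=(I_1,x_1,\dots,I_n,x_n)$ of $(\mathcal{I}_r\times\mathcal{X})^*=\bigcup_{k\in\mathbb{N}_0}(\mathcal{I}_r\times\mathcal{X})^k$, with the empty one denoted $\square$; $vI_rx$ is the concatenation of $v$ with $I_r\in\mathcal{I}_r$ and $x\in\mathcal{X}$. A prequential path is $\upsilon=(I_1,x_1,I_2,x_2,\dots)\in(\mathcal{I}_r\times\mathcal{X})^{\mathbb{N}}$, identified with the pair $(\iota,\omega)$ where $\iota=(I_1,I_2,\dots)$ and $\omega=(x_1,x_2,\dots)$, so $\iota_k=I_k$ and $\omega_k=x_k$; $\upsilon_{1:n}=(I_1,x_1,\dots,I_n,x_n)$. It is non-degenerate if $\iota_n\neq\{1-\omega_n\}$ for all $n\in\mathbb{N}$. A map between countable encoded sets (or to $\mathbb{Q}$) is recursive if it is computed by some Turing machine via encodings by natural numbers. A test superfarthingale is a map $F\colon(\mathcal{I}_r\times\mathcal{X})^*\to\mathbb{R}$ with $F\geq0$, $F(\square)=1$ and $\overline{E}_{I_r}(F(vI_r\,\cdot))\leq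 F(v)$ for all prequential situations $v$ and all $I_r\in\mathcal{I}_r$, where $F(vI_r\,\cdot)$ is the map $x\mapsto F(vI_rx)$. A map $r\colon\mathcal{D}\to\mathbb{R}$ on a countable encoded set $\mathcal{D}$ is lower semicomputable if there is a recursive map $q\colon\mathcal{D}\times\mathbb{N}_0\to\mathbb{Q}$ with $q(d,n)\leq q(d,n+1)$ and $\lim_{m\to\infty}q(d,m)=r(d)$ for all $d,n$. A prequential path $\upsilon$ is game-random if it is non-degenerate and all lower semicomputable test superfarthingales $F$ satisfy $\limsup_{n\to\infty}F(\upsilon_{1:n})<\infty$. *)

theory Defs
  imports Complex_Main "HOL-Library.Nat_Bijection" "HOL-Library.Extended_Real"
begin

(* Deterministic Turing machines with k two-way infinite tapes.  A tape is stored relative to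
   its head: cell 0 is the scanned cell, so a head movement shifts the contents.  Symbol 0 is
   the blank, symbol 1 the stroke used for unary numerals. *)

type_synonym tape = "int \<Rightarrow> nat"

datatype direction = GoLeft | Stay | GoRight

fun shift :: "direction \<Rightarrow> tape \<Rightarrow> tape" where
  "shift GoLeft t = (\<lambda>i. t (i - 1))"
| "shift Stay t = t"
| "shift GoRight t = (\<lambda>i. t (i + 1))"

fun act :: "nat \<times> direction \<Rightarrow> tape \<Rightarrow> tape" where
  "act (s, d) t = shift d (t(0 := s))"

(* The transition function is a partial map from a state and the k scanned symbols to a new
   state and, for each tape, a symbol to write and a head movement.  Finiteness of its domain
   makes the state set and the alphabet finite. *)

type_synonym tm = "nat \<times> nat list \<Rightarrow> (nat \<times> (nat \<times> direction) list) option"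

type_synonym config = "nat \<times> tape list"

definition turing_machine :: "nat \<Rightarrow> tm \<Rightarrow> bool" where
  "turing_machine k M \<longleftrightarrow> k \<ge> 1 \<and> finite (dom M) \<and>
     (\<forall>q ss q' as. M (q, ss) = Some (q', as) \<longrightarrow> length ss = k \<and> length as = k)"

fun tm_step :: "tm \<Rightarrow> config \<Rightarrow> config option" where
  "tm_step M (q, ts) =
     (case M (q, map (\<lambda>t. t 0) ts) of
        None \<Rightarrow> None
      | Some (q', as) \<Rightarrow> Some (q', map2 act as ts))"

definition blank_tape :: tape where
  "blank_tape = (\<lambda>_. 0)"

definition numeral_tape :: "nat \<Rightarrow> tape" where
  "numeral_tape n = (\<lambda>i. if 0 \<le> i \<and> i < int n then 1 else 0)"

definition standard_tapes :: "nat \<Rightarrow> nat \<Rightarrow> tape list" where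
  "standard_tapes k n = numeral_tape n # replicate (k - 1) blank_tape"

(* Started in state 0 with the numeral for m on the first tape, the machine halts (no
   transition applies) with the numeral for n on the first tape and all else blank. *)

definition tm_yields :: "nat \<Rightarrow> tm \<Rightarrow> nat \<Rightarrow> nat \<Rightarrow> bool" where
  "tm_yields k M m n \<longleftrightarrow>
     (\<exists>q. (\<lambda>c c'. tm_step M c = Some c')\<^sup>*\<^sup>* (0, standard_tapes k m) (q, standard_tapes k n) \<and>
          tm_step M (q, standard_tapes k n) = None)"


(* Encodings by natural numbers.  They are fixed explicitly, because the unspecified injections
   of class countable need not be effective. *)

class encodable =
  fixes encode :: "'a \<Rightarrow> nat"
  assumes inj_encode: "inj encode"

instantiation nat :: encodable
begin
definition "encode (n::nat) = n"
instance by standard (simp add: encode_nat_def inj_def)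
end

instantiation bool :: encodable
begin
definition "encode (b::bool) = (of_bool b :: nat)"
instance by standard (auto simp: encode_bool_def inj_def)
end

instantiation int :: encodable
begin
definition "encode (i::int) = int_encode i"
instance by standard (simp add: encode_int_def inj_def int_encode_eq)
end

instantiation prod :: (encodable, encodable) encodable
begin
definition "encode p = prod_encode (encode (fst p), encode (snd p))"
instance
  by standard (auto simp: encode_prod_def inj_def prod_eq_iff dest: injD[OF inj_encode])
end

instantiation list :: (encodable) encodable
begin
definition "encode xs = list_encode (map encode xs)"
instance
  by standard
    (auto simp: encode_list_def inj_def list_encode_eq inj_map_eq_map[OF inj_encode])
end

instantiation rat :: encodable
begin
definition "encode (r::rat) = encode (quotient_of r)"
instance
  by standard (metis (mono_tags, lifting) encode_rat_def injI inj_encode injD quotient_of_inject)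
end

definition recursive_map :: "('a::encodable \<Rightarrow> 'b::encodable) \<Rightarrow> bool" where
  "recursive_map f \<longleftrightarrow>
     (\<exists>k M. turing_machine k M \<and> (\<forall>x. tm_yields k M (encode x) (encode (f x))))"

definition lower_semicomputable :: "('a::encodable \<Rightarrow> real) \<Rightarrow> bool" where
  "lower_semicomputable r \<longleftrightarrow>
     (\<exists>q :: 'a \<times> nat \<Rightarrow> rat. recursive_map q \<and>
        (\<forall>d n. q (d, n) \<le> q (d, n + 1)) \<and>
        (\<forall>d. (\<lambda>m. real_of_rat (q (d, m))) \<longlonglongrightarrow> r d))"


(* Rational interval forecasts, given by their endpoints. *)

typedef rforecast = "{I :: rat \<times> rat. 0 \<le> fst I \<and> fst I \<le> snd I \<and> snd I \<le> 1}"
  by (rule exI[of _ "(0, 1)"]) simp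

instantiation rforecast :: encodable
begin
definition "encode I = encode (Rep_rforecast I)"
instance
  by standard (auto simp: encode_rforecast_def inj_def Rep_rforecast_inject dest: injD[OF inj_encode])
end

definition min_of :: "rforecast \<Rightarrow> real" where
  "min_of I = real_of_rat (fst (Rep_rforecast I))"

definition max_of :: "rforecast \<Rightarrow> real" where
  "max_of I = real_of_rat (snd (Rep_rforecast I))"

definition interval_of :: "rforecast \<Rightarrow> real set" where
  "interval_of I = {min_of I .. max_of I}"

(* Outcomes are booleans, True for 1 and False for 0.  On a non-empty compact interval the
   supremum below is a maximum. *)

definition upper_expectation :: "real set \<Rightarrow> (bool \<Rightarrow> real) \<Rightarrow> real" where
  "upper_expectation I f = (SUP p\<in>I. p * f True + (1 - p) * f False)"

lemma upper_expectation_attained: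
  "\<exists>p \<in> interval_of I. upper_expectation (interval_of I) f = p * f True + (1 - p) * f False \<and>
     (\<forall>p' \<in> interval_of I. p' * f True + (1 - p') * f False \<le> p * f True + (1 - p) * f False)"
proof -
  let ?g = "\<lambda>p::real. p * f True + (1 - p) * f False"
  have "min_of I \<le> max_of I"
    using Rep_rforecast[of I] by (auto simp: min_of_def max_of_def of_rat_less_eq)
  moreover have "continuous_on (interval_of I) ?g"
    by (intro continuous_intros)
  ultimately obtain p where p: "p \<in> interval_of I" "\<forall>p' \<in> interval_of I. ?g p' \<le> ?g p"
    using continuous_attains_sup[of "interval_of I" ?g]
    by (auto simp: interval_of_def)
  have "upper_expectation (interval_of I) f = ?g p"
    unfolding upper_expectation_def by (rule cSup_eq_maximum) (use p in auto)
  with p show ?thesis by blast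
qed

type_synonym situation = "(rforecast \<times> bool) list"

(* Paths are indexed from 0: their entry number k carries the forecast and the outcome that are
   numbered k+1 in the usual 1-based notation. *)

type_synonym path = "nat \<Rightarrow> rforecast \<times> bool"

definition forecast :: "path \<Rightarrow> nat \<Rightarrow> rforecast" where
  "forecast \<upsilon> k = fst (\<upsilon> k)"

definition outcome :: "path \<Rightarrow> nat \<Rightarrow> bool" where
  "outcome \<upsilon> k = snd (\<upsilon> k)"

definition initial_segment :: "path \<Rightarrow> nat \<Rightarrow> situation" where
  "initial_segment \<upsilon> n = map \<upsilon> [0..<n]"

definition non_degenerate :: "path \<Rightarrow> bool" where
  "non_degenerate \<upsilon> \<longleftrightarrow> (\<forall>k. interval_of (forecast \<upsilon> k) \<noteq> {1 - of_bool (outcome \<upsilon> k)})"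

definition test_superfarthingale :: "(situation \<Rightarrow> real) \<Rightarrow> bool" where
  "test_superfarthingale F \<longleftrightarrow>
     (\<forall>v. F v \<ge> 0) \<and> F [] = 1 \<and>
     (\<forall>v I. upper_expectation (interval_of I) (\<lambda>x. F (v @ [(I, x)])) \<le> F v)"

definition game_random :: "path \<Rightarrow> bool" where
  "game_random \<upsilon> \<longleftrightarrow> non_degenerate \<upsilon> \<and>
     (\<forall>F. test_superfarthingale F \<and> lower_semicomputable F \<longrightarrow>
        limsup (\<lambda>n. ereal (F (initial_segment \<upsilon> n))) < \<infinity>)"

end

theory Submission
  imports Defs
begin

text \<open>Bet on the selected rounds: for a natural number \<open>m \<ge> 2\<close> let \<open>F\<^sub>m\<close> be the product, over the
  selected rounds, of the factors \<open>1 + (\<omega>\<^sub>k - max \<iota>\<^sub>k) / m\<close>. The factors have upper expectation at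
  most 1, so \<open>F\<^sub>m\<close> is a test superfarthingale; it is rational and recursive in \<open>S\<close>, hence bounded along
  a game-random path. Since \<open>ln (1 + t) \<ge> t - 2 t\<^sup>2\<close> for \<open>\<bar>t\<bar> \<le> 1/2\<close>, a bound on \<open>ln F\<^sub>m\<close> forces the
  average of the selected gains \<open>\<omega>\<^sub>k - max \<iota>\<^sub>k\<close> to be eventually at most \<open>3 / m\<close>. The lower endpoints are
  treated in the same way with the gains \<open>min \<iota>\<^sub>k - \<omega>\<^sub>k\<close>.

  That \<open>F\<^sub>m\<close> is recursive needs Turing machines that call the machine of \<open>S\<close> as a subroutine. Because
  tapes are stored relative to the head and machines end in standard configuration, a machine can
  be run unchanged on a block of blank tapes of a larger machine, and a tape with its head on the
  first stroke is a counter whose increment, decrement and zero test take one or two steps.\<close>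

section \<open>Counter programs on Turing machines\<close>

abbreviation tm_steps :: "tm \<Rightarrow> config \<Rightarrow> config \<Rightarrow> bool" where
  "tm_steps M \<equiv> (\<lambda>c c'. tm_step M c = Some c')\<^sup>*\<^sup>*"

lemma tm_step_mono: "tm_step M c = Some c' \<Longrightarrow> M \<subseteq>\<^sub>m M' \<Longrightarrow> tm_step M' c = Some c'"
  by (cases c) (auto simp: map_le_def dom_def split: option.splits)

lemma tm_steps_mono: "tm_steps M c c' \<Longrightarrow> M \<subseteq>\<^sub>m M' \<Longrightarrow> tm_steps M' c c'"
  by (induction rule: rtranclp_induct) (auto intro: rtranclp.rtrancl_into_rtrancl tm_step_mono)

definition tapes :: "nat \<Rightarrow> nat list \<Rightarrow> tape list" where
  "tapes N rs = map numeral_tape (rs @ replicate (N - length rs) 0)"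

lemma numeral_tape_0: "numeral_tape 0 = blank_tape"
  by (auto simp: numeral_tape_def blank_tape_def)

lemma standard_tapes_eq: "standard_tapes k n = tapes k [n]"
  by (simp add: standard_tapes_def tapes_def numeral_tape_0)

lemma length_tapes: "length rs \<le> N \<Longrightarrow> length (tapes N rs) = N"
  by (simp add: tapes_def)

lemma tapes_nth: "i < length rs \<Longrightarrow> tapes N rs ! i = numeral_tape (rs ! i)"
  by (simp add: tapes_def nth_append)

lemma tapes_update: "i < length rs \<Longrightarrow> (tapes N rs)[i := numeral_tape n] = tapes N (rs[i := n])"
  by (simp add: tapes_def list_update_append map_update)

lemma numeral_tape_scan: "numeral_tape n 0 = (if n = 0 then 0 else 1)"
  by (simp add: numeral_tape_def)

lemma tapes_scan: "t \<in> set (tapes N rs) \<Longrightarrow> t 0 \<in> {0, 1}"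
  by (auto simp: tapes_def numeral_tape_scan simp del: One_nat_def split: if_splits)

text \<open>A fragment is entered in state \<open>a\<close> and left in state \<open>c\<close>; its own states are those from
  \<open>a\<close> up to but excluding \<open>c\<close>, so that consecutive fragments can be joined.\<close>

definition fragment :: "nat \<Rightarrow> nat \<Rightarrow> nat \<Rightarrow> tm \<Rightarrow> bool" where
  "fragment N a c M \<longleftrightarrow> a \<le> c \<and> finite (dom M) \<and>
     (\<forall>q ss q' as. M (q, ss) = Some (q', as) \<longrightarrow> a \<le> q \<and> q < c \<and> length ss = N \<and> length as = N)"

text \<open>Disjoint state ranges give disjoint domains, so neither table overrides the other and
  \<open>tm_steps_mono\<close> carries the runs of both parts over to the union.\<close>

lemma fragment_join:
  assumes "fragment N a b M1" "fragment N b c M2"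
  shows "fragment N a c (M1 ++ M2)" "M1 \<subseteq>\<^sub>m M1 ++ M2" "M2 \<subseteq>\<^sub>m M1 ++ M2"
proof -
  have "dom M1 \<inter> dom M2 = {}"
    using assms unfolding fragment_def by (fastforce simp: dom_def)
  then show "M1 \<subseteq>\<^sub>m M1 ++ M2"
    by (metis map_add_comm map_le_map_add)
  show "fragment N a c (M1 ++ M2)"
    using assms unfolding fragment_def by (fastforce simp: map_add_Some_iff)
qed simp

text \<open>Only rows with scanned symbols 0 and 1 are present: numerals use no others, and the
  table stays finite. \<open>g\<close> maps the symbol scanned on tape \<open>i\<close> to the next
  state, the symbol to write and the move; the other tapes are rewritten as scanned.\<close>

definition instr :: "nat \<Rightarrow> nat \<Rightarrow> nat \<Rightarrow> (nat \<Rightarrow> nat \<times> nat \<times> direction) \<Rightarrow> tm" where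
  "instr N a i g = (\<lambda>(q, ss). if q = a \<and> length ss = N \<and> set ss \<subseteq> {0, 1}
     then (case g (ss ! i) of (q', s, d) \<Rightarrow> Some (q', (map (\<lambda>s. (s, Stay)) ss)[i := (s, d)]))
     else None)"

lemma fragment_instr: "fragment N a (Suc a) (instr N a i g)"
proof -
  have "dom (instr N a i g) \<subseteq> {a} \<times> {ss. set ss \<subseteq> {0, 1} \<and> length ss = N}"
    by (auto simp: instr_def split: if_splits)
  moreover have "finite ({a} \<times> {ss::nat list. set ss \<subseteq> {0, 1} \<and> length ss = N})"
    by (intro finite_cartesian_product finite_lists_length_eq) auto
  ultimately have "finite (dom (instr N a i g))"
    by (rule finite_subset)
  then show ?thesis
    by (auto simp: fragment_def instr_def split: if_splits prod.splits)
qed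

lemma map2_act_Stay: "map2 act (map (\<lambda>s. (s, Stay)) (map (\<lambda>t. t 0) ts)) ts = ts"
  by (rule nth_equalityI) auto

lemma step_instr:
  assumes "length rs \<le> N" "i < length rs"
    and "g (if rs ! i = 0 then 0 else 1) = (q', s, d)"
  shows "tm_step (instr N a i g) (a, tapes N rs) =
    Some (q', (tapes N rs)[i := act (s, d) (numeral_tape (rs ! i))])"
proof -
  let ?ts = "tapes N rs"
  have i: "i < length ?ts" using assms by (simp add: length_tapes)
  have "map2 act ((map (\<lambda>s. (s, Stay)) (map (\<lambda>t. t 0) ?ts))[i := (s, d)]) ?ts =
     (map2 act (map (\<lambda>s. (s, Stay)) (map (\<lambda>t. t 0) ?ts)) ?ts)[i := act (s, d) (?ts ! i)]"
    using i by (intro nth_equalityI) (auto simp: nth_list_update)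
  then have "map2 act ((map (\<lambda>s. (s, Stay)) (map (\<lambda>t. t 0) ?ts))[i := (s, d)]) ?ts =
     ?ts[i := act (s, d) (numeral_tape (rs ! i))]"
    unfolding map2_act_Stay using assms by (simp add: tapes_nth)
  moreover have "(\<lambda>t. t 0) ` set ?ts \<subseteq> {0, 1}"
    using tapes_scan[of _ N rs] by (intro image_subsetI) auto
  ultimately show ?thesis
    using assms i by (simp add: instr_def length_tapes tapes_nth numeral_tape_scan comp_def)
qed

text \<open>The head rests on the first stroke, so one scanned cell decides whether the register is
  zero. Writing it back makes this a test without side effect.\<close>

lemma step_instr_goto:
  assumes "length rs \<le> N" "i < length rs"
  shows "tm_step (instr N a i (\<lambda>s. (g s, s, Stay))) (a, tapes N rs) =
    Some (g (if rs ! i = 0 then 0 else 1), tapes N rs)"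
proof -
  let ?s = "if rs ! i = 0 then 0 else 1 :: nat"
  have "tm_step (instr N a i (\<lambda>s. (g s, s, Stay))) (a, tapes N rs) =
    Some (g ?s, (tapes N rs)[i := act (?s, Stay) (numeral_tape (rs ! i))])"
    using assms by (intro step_instr) auto
  also have "act (?s, Stay) (numeral_tape (rs ! i)) = numeral_tape (rs ! i)"
    by (auto simp: numeral_tape_def)
  finally show ?thesis using assms by (simp add: tapes_update)
qed

text \<open>Register \<open>i\<close> is the numeral on tape \<open>i\<close>. The tapes beyond the \<open>L\<close> registers are blank before
  and after; they are workspace for subroutines.\<close>

definition program :: "nat \<Rightarrow> (nat list \<Rightarrow> nat list \<Rightarrow> bool) \<Rightarrow> bool" where
  "program L R \<longleftrightarrow> (\<exists>N0\<ge>L. \<forall>N\<ge>N0. \<forall>a. \<exists>c M. fragment N a c M \<and>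
     (\<forall>rs rs'. length rs = L \<longrightarrow> R rs rs' \<longrightarrow>
        length rs' = L \<and> tm_steps M (a, tapes N rs) (c, tapes N rs')))"

text \<open>A larger relation promises more runs, so passing to a smaller one is free. Preconditions
  such as an empty scratch register enter in this way.\<close>

lemma program_weaken:
  assumes "program L R" "\<And>rs rs'. length rs = L \<Longrightarrow> R' rs rs' \<Longrightarrow> R rs rs'"
  shows "program L R'"
  using assms unfolding program_def by meson

text \<open>This is why \<open>program\<close> quantifies over all large \<open>N\<close> and all
  entry states: both parts can be built for the same number of tapes, the second one entered where
  the first is left.\<close>

lemma program_seq:
  assumes "program L R1" "program L R2"
  shows "program L (R1 OO R2)"
proof -
  obtain N1 where N1: "N1 \<ge> L" "\<And>N a. N \<ge> N1 \<Longrightarrow> \<exists>c M. fragment N a c M \<and>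
     (\<forall>rs rs'. length rs = L \<longrightarrow> R1 rs rs' \<longrightarrow>
        length rs' = L \<and> tm_steps M (a, tapes N rs) (c, tapes N rs'))"
    using assms(1) unfolding program_def by blast
  obtain N2 where N2: "N2 \<ge> L" "\<And>N a. N \<ge> N2 \<Longrightarrow> \<exists>c M. fragment N a c M \<and>
     (\<forall>rs rs'. length rs = L \<longrightarrow> R2 rs rs' \<longrightarrow>
        length rs' = L \<and> tm_steps M (a, tapes N rs) (c, tapes N rs'))"
    using assms(2) unfolding program_def by blast
  show ?thesis unfolding program_def
  proof (rule exI[of _ "max N1 N2"], intro conjI allI impI)
    show "L \<le> max N1 N2" using N1 by simp
    fix N a assume N: "max N1 N2 \<le> N"
    obtain b M1 where M1: "fragment N a b M1" "\<And>rs rs'. length rs = L \<Longrightarrow> R1 rs rs' \<Longrightarrow>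
        length rs' = L \<and> tm_steps M1 (a, tapes N rs) (b, tapes N rs')"
      using N1(2)[of N a] N by auto
    obtain c M2 where M2: "fragment N b c M2" "\<And>rs rs'. length rs = L \<Longrightarrow> R2 rs rs' \<Longrightarrow>
        length rs' = L \<and> tm_steps M2 (b, tapes N rs) (c, tapes N rs')"
      using N2(2)[of N b] N by auto
    note j = fragment_join[OF M1(1) M2(1)]
    show "\<exists>c M. fragment N a c M \<and> (\<forall>rs rs'. length rs = L \<longrightarrow> (R1 OO R2) rs rs' \<longrightarrow>
        length rs' = L \<and> tm_steps M (a, tapes N rs) (c, tapes N rs'))"
    proof (intro exI[of _ c] exI[of _ "M1 ++ M2"] conjI allI impI j(1))
      fix rs rs' assume "length rs = L" "(R1 OO R2) rs rs'"
      then obtain rs1 where r: "R1 rs rs1" "R2 rs1 rs'" by auto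
      note s1 = M1(2)[OF \<open>length rs = L\<close> r(1)]
      note s2 = M2(2)[OF conjunct1[OF s1] r(2)]
      show "length rs' = L" using s2 by simp
      show "tm_steps (M1 ++ M2) (a, tapes N rs) (c, tapes N rs')"
        using tm_steps_mono[OF conjunct2[OF s1] j(2)] tm_steps_mono[OF conjunct2[OF s2] j(3)]
        by (rule rtranclp_trans)
    qed
  qed
qed

section \<open>Increment and decrement of a counter\<close>

text \<open>Numerals grow on the left: the head moves onto the blank cell before the first stroke
  and writes a stroke there. This takes two instructions because \<open>act\<close> writes before it
  moves.\<close>

lemma program_inc:
  assumes "i < L"
  shows "program L (\<lambda>rs rs'. rs' = rs[i := Suc (rs ! i)])"
  unfolding program_def
proof (rule exI[of _ L], intro conjI allI impI order_refl)
  fix N a assume N: "L \<le> N"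
  let ?M1 = "instr N a i (\<lambda>s. (Suc a, s, GoLeft))"
  let ?M2 = "instr N (Suc a) i (\<lambda>s. (Suc (Suc a), 1, Stay))"
  note j = fragment_join[OF fragment_instr fragment_instr]
  show "\<exists>c M. fragment N a c M \<and> (\<forall>rs rs'. length rs = L \<longrightarrow> rs' = rs[i := Suc (rs ! i)] \<longrightarrow>
        length rs' = L \<and> tm_steps M (a, tapes N rs) (c, tapes N rs'))"
  proof (intro exI[of _ "Suc (Suc a)"] exI[of _ "?M1 ++ ?M2"] conjI allI impI j(1))
    fix rs rs' :: "nat list" assume l: "length rs = L" and rs': "rs' = rs[i := Suc (rs ! i)]"
    show "length rs' = L" using l rs' by simp
    let ?s = "if rs ! i = 0 then 0 else 1 :: nat"
    let ?t = "act (?s, GoLeft) (numeral_tape (rs ! i))"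
    \<comment> \<open>Between the two instructions tape \<open>i\<close> need not be a numeral tape,
      since the scanned cell is blank and strokes may follow. So \<open>step_instr\<close> does not
      apply and the second step is computed directly.\<close>
    let ?ts = "(tapes N rs)[i := ?t]"
    have 1: "tm_step ?M1 (a, tapes N rs) = Some (Suc a, ?ts)"
      using assms l N by (intro step_instr) auto
    have len: "length ?ts = N" "i < length ?ts" using assms l N by (auto simp: length_tapes)
    have t0: "?t 0 = 0" by (simp add: numeral_tape_def)
    have scan: "(\<lambda>t. t 0) ` set ?ts \<subseteq> {0, 1}"
      using tapes_scan[of _ N rs] t0 set_update_subset_insert[of "tapes N rs" i ?t] by fastforce
    have m: "map2 act ((map (\<lambda>s. (s, Stay)) (map (\<lambda>t. t 0) ?ts))[i := (1, Stay)]) ?ts =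
       (map2 act (map (\<lambda>s. (s, Stay)) (map (\<lambda>t. t 0) ?ts)) ?ts)[i := act (1, Stay) (?ts ! i)]"
      using len by (intro nth_equalityI) (auto simp: nth_list_update)
    have "act (1, Stay) ?t = numeral_tape (Suc (rs ! i))"
      by (auto simp: numeral_tape_def fun_eq_iff)
    then have "?ts[i := act (1, Stay) (?ts ! i)] = tapes N rs'"
      using len rs' l assms by (simp add: tapes_update)
    with m have m': "map2 act ((map (\<lambda>s. (s, Stay)) (map (\<lambda>t. t 0) ?ts))[i := (1, Stay)]) ?ts = tapes N rs'"
      unfolding map2_act_Stay by simp
    have 2: "tm_step ?M2 (Suc a, ?ts) = Some (Suc (Suc a), tapes N rs')"
      using scan len m' by (simp add: instr_def del: act.simps)
    show "tm_steps (?M1 ++ ?M2) (a, tapes N rs) (Suc (Suc a), tapes N rs')"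
      using tm_step_mono[OF 1 j(2)] tm_step_mono[OF 2 j(3)]
      by (meson converse_rtranclp_into_rtranclp r_into_rtranclp)
  qed
qed

text \<open>Erasing the first stroke and moving right puts the head on the next one. A blank tape
  stays blank, in agreement with truncated subtraction at 0.\<close>

lemma program_dec:
  assumes "i < L"
  shows "program L (\<lambda>rs rs'. rs' = rs[i := rs ! i - 1])"
  unfolding program_def
proof (rule exI[of _ L], intro conjI allI impI order_refl)
  fix N a assume N: "L \<le> N"
  let ?M = "instr N a i (\<lambda>s. (Suc a, 0, GoRight))"
  show "\<exists>c M. fragment N a c M \<and> (\<forall>rs rs'. length rs = L \<longrightarrow> rs' = rs[i := rs ! i - 1] \<longrightarrow>
        length rs' = L \<and> tm_steps M (a, tapes N rs) (c, tapes N rs'))"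
  proof (intro exI[of _ "Suc a"] exI[of _ ?M] conjI allI impI fragment_instr)
    fix rs rs' :: "nat list" assume l: "length rs = L" and rs': "rs' = rs[i := rs ! i - 1]"
    show "length rs' = L" using l rs' by simp
    have "tm_step ?M (a, tapes N rs) =
        Some (Suc a, (tapes N rs)[i := act (0, GoRight) (numeral_tape (rs ! i))])"
      using assms l N by (intro step_instr) auto
    moreover have "act (0, GoRight) (numeral_tape (rs ! i)) = numeral_tape (rs ! i - 1)"
      by (auto simp: numeral_tape_def fun_eq_iff)
    ultimately have "tm_step ?M (a, tapes N rs) = Some (Suc a, tapes N rs')"
      using assms l rs' by (simp add: tapes_update)
    then show "tm_steps ?M (a, tapes N rs) (Suc a, tapes N rs')" by blast
  qed
qed

section \<open>Branches and loops\<close>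

text \<open>Layout: a test in state \<open>a\<close>, the code for \<open>R1\<close> from
  \<open>Suc a\<close>, in state \<open>b\<close> a jump over the code for \<open>R2\<close>, which
  starts at \<open>Suc b\<close>. Both branches leave in \<open>c\<close>.\<close>

lemma program_if:
  assumes "program L R1" "program L R2" "i < L"
  shows "program L (\<lambda>rs rs'. if rs ! i = 0 then R1 rs rs' else R2 rs rs')"
proof -
  obtain N1 where N1: "N1 \<ge> L" "\<And>N a. N \<ge> N1 \<Longrightarrow> \<exists>c M. fragment N a c M \<and>
     (\<forall>rs rs'. length rs = L \<longrightarrow> R1 rs rs' \<longrightarrow>
        length rs' = L \<and> tm_steps M (a, tapes N rs) (c, tapes N rs'))"
    using assms(1) unfolding program_def by blast
  obtain N2 where N2: "N2 \<ge> L" "\<And>N a. N \<ge> N2 \<Longrightarrow> \<exists>c M. fragment N a c M \<and>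
     (\<forall>rs rs'. length rs = L \<longrightarrow> R2 rs rs' \<longrightarrow>
        length rs' = L \<and> tm_steps M (a, tapes N rs) (c, tapes N rs'))"
    using assms(2) unfolding program_def by blast
  show ?thesis unfolding program_def
  proof (rule exI[of _ "max N1 N2"], intro conjI allI impI)
    show "L \<le> max N1 N2" using N1 by simp
    fix N a assume N: "max N1 N2 \<le> N"
    obtain b M1 where M1: "fragment N (Suc a) b M1" "\<And>rs rs'. length rs = L \<Longrightarrow> R1 rs rs' \<Longrightarrow>
        length rs' = L \<and> tm_steps M1 (Suc a, tapes N rs) (b, tapes N rs')"
      using N1(2)[of N "Suc a"] N by auto
    obtain c M2 where M2: "fragment N (Suc b) c M2" "\<And>rs rs'. length rs = L \<Longrightarrow> R2 rs rs' \<Longrightarrow>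
        length rs' = L \<and> tm_steps M2 (Suc b, tapes N rs) (c, tapes N rs')"
      using N2(2)[of N "Suc b"] N by auto
    let ?T = "instr N a i (\<lambda>s. (if s = 0 then Suc a else Suc b, s, Stay))"
    let ?J = "instr N b i (\<lambda>s. (c, s, Stay))"
    let ?M = "?T ++ (M1 ++ (?J ++ M2))"
    note j1 = fragment_join[OF fragment_instr[of N b i "\<lambda>s. (c, s, Stay)"] M2(1)]
    note j2 = fragment_join[OF M1(1) j1(1)]
    note j3 = fragment_join[OF fragment_instr[of N a i "\<lambda>s. (if s = 0 then Suc a else Suc b, s, Stay)"] j2(1)]
    have sub: "?T \<subseteq>\<^sub>m ?M" "M1 \<subseteq>\<^sub>m ?M" "?J \<subseteq>\<^sub>m ?M" "M2 \<subseteq>\<^sub>m ?M"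
      using j1(2,3) j2(2,3) j3(2,3) by (blast intro: map_le_trans)+
    show "\<exists>c M. fragment N a c M \<and> (\<forall>rs rs'. length rs = L \<longrightarrow>
        (if rs ! i = 0 then R1 rs rs' else R2 rs rs') \<longrightarrow>
        length rs' = L \<and> tm_steps M (a, tapes N rs) (c, tapes N rs'))"
    proof (intro exI[of _ c] exI[of _ ?M] conjI[OF j3(1)] allI impI)
      fix rs rs' :: "nat list" assume l: "length rs = L" and r: "if rs ! i = 0 then R1 rs rs' else R2 rs rs'"
      have "tm_step ?T (a, tapes N rs) =
          Some (if (if rs ! i = 0 then 0 else 1::nat) = 0 then Suc a else Suc b, tapes N rs)"
        using l N N1 assms by (intro step_instr_goto) auto
      then have t: "tm_step ?M (a, tapes N rs) = Some (if rs ! i = 0 then Suc a else Suc b, tapes N rs)"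
        using tm_step_mono[OF _ sub(1)] by auto
      show "length rs' = L \<and> tm_steps ?M (a, tapes N rs) (c, tapes N rs')"
      proof (cases "rs ! i = 0")
        case True
        with r have s: "length rs' = L \<and> tm_steps M1 (Suc a, tapes N rs) (b, tapes N rs')"
          using M1(2) l by simp
        have "tm_step ?J (b, tapes N rs') = Some (c, tapes N rs')"
          using s N N1 assms step_instr_goto[of rs' N i b "\<lambda>_. c"] by auto
        then have "tm_step ?M (b, tapes N rs') = Some (c, tapes N rs')"
          using tm_step_mono[OF _ sub(3)] by auto
        moreover have "tm_steps ?M (Suc a, tapes N rs) (b, tapes N rs')"
          using s tm_steps_mono[OF _ sub(2)] by blast
        moreover have "tm_step ?M (a, tapes N rs) = Some (Suc a, tapes N rs)"
          using t True by simp
        ultimately have "tm_steps ?M (a, tapes N rs) (c, tapes N rs')"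
          by (meson converse_rtranclp_into_rtranclp rtranclp.rtrancl_into_rtrancl)
        then show ?thesis using s by blast
      next
        case False
        with r have s: "length rs' = L \<and> tm_steps M2 (Suc b, tapes N rs) (c, tapes N rs')"
          using M2(2) l by simp
        then have "tm_steps ?M (Suc b, tapes N rs) (c, tapes N rs')"
          using tm_steps_mono[OF _ sub(4)] by blast
        moreover have "tm_step ?M (a, tapes N rs) = Some (Suc b, tapes N rs)"
          using t False by simp
        ultimately show ?thesis using s
          by (meson converse_rtranclp_into_rtranclp)
      qed
    qed
  qed
qed

text \<open>Layout: a test in state \<open>a\<close>, the body from \<open>Suc a\<close>, a jump
  back from \<open>b\<close>, the exit \<open>Suc b\<close>. Termination is left to the user: the
  relation contains only pairs for which the iteration does reach zero.\<close>

lemma program_while: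
  assumes "program L R" "i < L"
  shows "program L (\<lambda>rs rs'. (\<lambda>rs rs'. rs ! i \<noteq> 0 \<and> R rs rs')\<^sup>*\<^sup>* rs rs' \<and> rs' ! i = 0)"
proof -
  obtain N1 where N1: "N1 \<ge> L" "\<And>N a. N \<ge> N1 \<Longrightarrow> \<exists>c M. fragment N a c M \<and>
     (\<forall>rs rs'. length rs = L \<longrightarrow> R rs rs' \<longrightarrow>
        length rs' = L \<and> tm_steps M (a, tapes N rs) (c, tapes N rs'))"
    using assms(1) unfolding program_def by blast
  show ?thesis unfolding program_def
  proof (rule exI[of _ N1], intro conjI[OF N1(1)] allI impI)
    fix N a assume N: "N1 \<le> N"
    obtain b M where M: "fragment N (Suc a) b M" "\<And>rs rs'. length rs = L \<Longrightarrow> R rs rs' \<Longrightarrow>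
        length rs' = L \<and> tm_steps M (Suc a, tapes N rs) (b, tapes N rs')"
      using N1(2)[of N "Suc a"] N by auto
    let ?T = "instr N a i (\<lambda>s. (if s = 0 then Suc b else Suc a, s, Stay))"
    let ?J = "instr N b i (\<lambda>s. (a, s, Stay))"
    let ?M = "?T ++ (M ++ ?J)"
    note j1 = fragment_join[OF M(1) fragment_instr[of N b i "\<lambda>s. (a, s, Stay)"]]
    note j2 = fragment_join[OF fragment_instr[of N a i "\<lambda>s. (if s = 0 then Suc b else Suc a, s, Stay)"] j1(1)]
    have sub: "?T \<subseteq>\<^sub>m ?M" "M \<subseteq>\<^sub>m ?M" "?J \<subseteq>\<^sub>m ?M"
      using j1(2,3) j2(2,3) by (blast intro: map_le_trans)+
    have t: "tm_step ?M (a, tapes N rs) = Some (if rs ! i = 0 then Suc b else Suc a, tapes N rs)"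
      if "length rs = L" for rs
    proof -
      have "tm_step ?T (a, tapes N rs) =
          Some (if (if rs ! i = 0 then 0 else 1::nat) = 0 then Suc b else Suc a, tapes N rs)"
        using that N N1 assms by (intro step_instr_goto) auto
      then show ?thesis using tm_step_mono[OF _ sub(1)] by auto
    qed
    have loop: "length rs' = L \<and> tm_steps ?M (a, tapes N rs) (a, tapes N rs')"
      if "(\<lambda>rs rs'. rs ! i \<noteq> 0 \<and> R rs rs')\<^sup>*\<^sup>* rs rs'" "length rs = L" for rs rs'
      using that
    proof (induction rule: rtranclp_induct)
      case (step rs1 rs2)
      then have l: "length rs1 = L" and 1: "tm_steps ?M (a, tapes N rs) (a, tapes N rs1)" by auto
      have 2: "tm_step ?M (a, tapes N rs1) = Some (Suc a, tapes N rs1)"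
        using t[OF l] step by simp
      have s: "length rs2 = L" "tm_steps M (Suc a, tapes N rs1) (b, tapes N rs2)"
        using M(2) l step by auto
      have 3: "tm_steps ?M (Suc a, tapes N rs1) (b, tapes N rs2)"
        using tm_steps_mono[OF s(2) sub(2)] .
      have "tm_step ?J (b, tapes N rs2) = Some (a, tapes N rs2)"
        using s N N1 assms step_instr_goto[of rs2 N i b "\<lambda>_. a"] by auto
      then have 4: "tm_step ?M (b, tapes N rs2) = Some (a, tapes N rs2)"
        using tm_step_mono[OF _ sub(3)] by auto
      show ?case using 1 2 3 4 s(1)
        by (meson rtranclp.rtrancl_into_rtrancl rtranclp_trans)
    qed simp
    show "\<exists>c M. fragment N a c M \<and> (\<forall>rs rs'. length rs = L \<longrightarrow>
        (\<lambda>rs rs'. rs ! i \<noteq> 0 \<and> R rs rs')\<^sup>*\<^sup>* rs rs' \<and> rs' ! i = 0 \<longrightarrow>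
        length rs' = L \<and> tm_steps M (a, tapes N rs) (c, tapes N rs'))"
    proof (intro exI[of _ "Suc b"] exI[of _ ?M] conjI[OF j2(1)] allI impI)
      fix rs rs' :: "nat list" assume l: "length rs = L"
        and r: "(\<lambda>rs rs'. rs ! i \<noteq> 0 \<and> R rs rs')\<^sup>*\<^sup>* rs rs' \<and> rs' ! i = 0"
      note s = loop[OF conjunct1[OF r] l]
      then show "length rs' = L \<and> tm_steps ?M (a, tapes N rs) (Suc b, tapes N rs')"
        using t[of rs'] r by (auto intro: rtranclp.rtrancl_into_rtrancl)
    qed
  qed
qed

section \<open>Calling a machine as a subroutine\<close>

text \<open>Runs \<open>M\<close>, with its states shifted by \<open>a\<close>, on the tapes from \<open>B\<close> to \<open>B + k - 1\<close>; where \<open>M\<close> halts,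
  control passes to state \<open>a + Q\<close>. The bounds \<open>Q\<close> and \<open>A\<close> on states and symbols keep the table finite.\<close>

definition call_table :: "nat \<Rightarrow> nat \<Rightarrow> nat \<Rightarrow> nat \<Rightarrow> nat \<Rightarrow> nat \<Rightarrow> tm \<Rightarrow> tm" where
  "call_table N a B k Q A M = (\<lambda>(q, ss).
     if a \<le> q \<and> q < a + Q \<and> length ss = N \<and> set ss \<subseteq> {..<A}
     then (case M (q - a, take k (drop B ss)) of
         None \<Rightarrow> Some (a + Q, map (\<lambda>s. (s, Stay)) ss)
       | Some (q', as) \<Rightarrow> Some (a + q',
           map (\<lambda>s. (s, Stay)) (take B ss) @ as @ map (\<lambda>s. (s, Stay)) (drop (B + k) ss)))
     else None)"

lemma fragment_call_table:
  assumes "turing_machine k M" "B + k \<le> N"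
  shows "fragment N a (a + Q) (call_table N a B k Q A M)"
proof -
  have "dom (call_table N a B k Q A M) \<subseteq> {a..<a+Q} \<times> {ss. set ss \<subseteq> {..<A} \<and> length ss = N}"
    by (auto simp: call_table_def split: if_splits)
  moreover have "finite ({a..<a+Q} \<times> {ss::nat list. set ss \<subseteq> {..<A} \<and> length ss = N})"
    by (intro finite_cartesian_product finite_lists_length_eq) auto
  ultimately have "finite (dom (call_table N a B k Q A M))"
    by (rule finite_subset)
  with assms show ?thesis
    by (fastforce simp: fragment_def call_table_def turing_machine_def split: if_splits prod.splits option.splits)
qed

lemma step_call_table:
  assumes M: "turing_machine k M" and step: "tm_step M (q, ts) = Some (q', ts')"
    and len: "length pre = B" "length ts = k" "length post = N - (B + k)" "B + k \<le> N"
    and q: "q < Q" and sym: "(\<lambda>t. t 0) ` set (pre @ ts @ post) \<subseteq> {..<A}"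
  shows "tm_step (call_table N a B k Q A M) (a + q, pre @ ts @ post) = Some (a + q', pre @ ts' @ post)"
    and "length ts' = k"
proof -
  obtain as where as: "M (q, map (\<lambda>t. t 0) ts) = Some (q', as)" "ts' = map2 act as ts"
    using step by (auto split: option.splits)
  have las: "length as = k" using M as unfolding turing_machine_def by blast
  show "length ts' = k" using as las len by simp
  have "map2 act (map (\<lambda>s. (s, Stay)) (map (\<lambda>t. t 0) pre) @ as @ map (\<lambda>s. (s, Stay)) (map (\<lambda>t. t 0) post))
      (pre @ ts @ post) = pre @ ts' @ post"
    using las len as by (simp add: zip_append map2_act_Stay[unfolded map_map comp_def] comp_def)
  then show "tm_step (call_table N a B k Q A M) (a + q, pre @ ts @ post) = Some (a + q', pre @ ts' @ post)"
    using as len q sym by (simp add: call_table_def image_Un)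
qed

lemma halt_call_table:
  assumes "tm_step M (q, ts) = None" "q < Q"
    and "length pre = B" "length ts = k" "length post = N - (B + k)" "B + k \<le> N"
    and "(\<lambda>t. t 0) ` set (pre @ ts @ post) \<subseteq> {..<A}"
  shows "tm_step (call_table N a B k Q A M) (a + q, pre @ ts @ post) = Some (a + Q, pre @ ts @ post)"
proof -
  have "M (q, map (\<lambda>t. t 0) ts) = None"
    using assms(1) by (auto split: option.splits)
  then have "tm_step (call_table N a B k Q A M) (a + q, pre @ ts @ post) =
      Some (a + Q, map2 act (map (\<lambda>s. (s, Stay)) (map (\<lambda>t. t 0) (pre @ ts @ post))) (pre @ ts @ post))"
    using assms by (simp add: call_table_def image_Un)
  then show ?thesis unfolding map2_act_Stay .
qed

lemma program_call:
  assumes M: "turing_machine k M" and yields: "\<And>x. x \<in> D \<Longrightarrow> tm_yields k M x (f x)"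
  shows "program (Suc B) (\<lambda>rs rs'. rs ! B \<in> D \<and> rs' = rs[B := f (rs ! B)])"
proof -
  have fin: "finite (dom M)" and k: "k \<ge> 1" using M by (auto simp: turing_machine_def)
  \<comment> \<open>\<open>Q\<close> has to exceed the initial state 0 and every state that the
    table mentions, as a source or as a target.\<close>
  have "finite (insert 0 (fst ` dom M \<union> (\<lambda>x. fst (the (M x))) ` dom M))"
    using fin by simp
  then obtain Q where "\<forall>q \<in> insert 0 (fst ` dom M \<union> (\<lambda>x. fst (the (M x))) ` dom M). q < Q"
    using finite_nat_set_iff_bounded by blast
  then have bound: "0 < Q" "\<And>x. x \<in> dom M \<Longrightarrow> fst x < Q \<and> fst (the (M x)) < Q"
    by simp_all
  have Q: "q < Q \<and> q' < Q" if "M (q, ss) = Some (q', as)" for q ss q' as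
    using bound(2)[of "(q, ss)"] that by (simp add: domI)
  \<comment> \<open>Each configuration of the run either steps, so that its scanned symbols form a
    row of the table, or is the final one and shows numerals only. Bounding the rows and 0, 1 thus
    covers every scan.\<close>
  have "finite ({0, 1} \<union> (\<Union>x\<in>dom M. set (snd x)))"
    using fin by simp
  then obtain A where "\<forall>s \<in> {0, 1} \<union> (\<Union>x\<in>dom M. set (snd x)). s < A"
    using finite_nat_set_iff_bounded by blast
  then have A: "0 < A" "1 < A" and sym_bound: "\<And>x s. x \<in> dom M \<Longrightarrow> s \<in> set (snd x) \<Longrightarrow> s < A"
    by auto
  have A': "set ss \<subseteq> {..<A}" if "M (q, ss) = Some (q', as)" for q ss q' as
    using sym_bound[of "(q, ss)"] that by (auto simp: domI)
  show ?thesis unfolding program_def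
  proof (rule exI[of _ "B + k"], intro conjI allI impI)
    show "Suc B \<le> B + k" using k by simp
    fix N a assume N: "B + k \<le> N"
    let ?C = "call_table N a B k Q A M"
    show "\<exists>c M. fragment N a c M \<and> (\<forall>rs rs'. length rs = Suc B \<longrightarrow>
        rs ! B \<in> D \<and> rs' = rs[B := f (rs ! B)] \<longrightarrow>
        length rs' = Suc B \<and> tm_steps M (a, tapes N rs) (c, tapes N rs'))"
    proof (intro exI[of _ "a + Q"] exI[of _ ?C] conjI[OF fragment_call_table[OF M N]] allI impI)
      fix rs rs' assume l: "length rs = Suc B" and r: "rs ! B \<in> D \<and> rs' = rs[B := f (rs ! B)]"
      let ?pre = "map numeral_tape (take B rs)"
      let ?post = "replicate (N - (B + k)) blank_tape"
      have sym: "(\<lambda>t. t 0) ` set (?pre @ ts @ ?post) \<subseteq> {..<A}" if "(\<lambda>t. t 0) ` set ts \<subseteq> {..<A}" for ts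
        using that A by (auto simp: numeral_tape_scan blank_tape_def)
      have rs_eq: "rs = take B rs @ [rs ! B]"
        using l by (metis lessI take_Suc_conv_app_nth order_refl take_all)
      have tapes_eq: "tapes N (take B rs @ [n]) = ?pre @ tapes k [n] @ ?post" for n
      proof -
        have "N - Suc B = (k - 1) + (N - (B + k))" using k N by simp
        then show ?thesis using l
          by (simp add: tapes_def numeral_tape_0 replicate_add)
      qed
      have rs'_eq: "rs' = take B rs @ [f (rs ! B)]"
        using r l rs_eq
        by (metis length_take lessI list_update_length min.absorb4)
      obtain q where q: "tm_steps M (0, tapes k [rs ! B]) (q, tapes k [f (rs ! B)])"
        "tm_step M (q, tapes k [f (rs ! B)]) = None"
        using yields r unfolding tm_yields_def standard_tapes_eq by blast
      have run: "tm_steps ?C (a, ?pre @ tapes k [rs ! B] @ ?post) (a + q, ?pre @ ts @ ?post) \<and>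
          q < Q \<and> length ts = k"
        if "tm_steps M (0, tapes k [rs ! B]) (q, ts)" for q ts
        using that
      proof (induction "(q, ts)" arbitrary: q ts rule: rtranclp_induct)
        case base
        then show ?case using bound k by (simp add: length_tapes)
      next
        case (step c)
        obtain q1 ts1 where c: "c = (q1, ts1)" by force
        note s = step(2)[unfolded c]
        obtain as where as: "M (q1, map (\<lambda>t. t 0) ts1) = Some (q, as)"
          using s by (auto split: option.splits)
        have IH: "tm_steps ?C (a, ?pre @ tapes k [rs ! B] @ ?post) (a + q1, ?pre @ ts1 @ ?post)"
          "q1 < Q" "length ts1 = k" using step(3)[OF c] by auto
        have "(\<lambda>t. t 0) ` set ts1 \<subseteq> {..<A}"
          using A'[OF as] by simp
        note st = step_call_table[OF M s _ IH(3) _ N IH(2) sym[OF this], simplified]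
        show ?case using IH(1) st l N Q[OF as]
          by (auto intro: rtranclp.rtrancl_into_rtrancl)
      qed
      note e = run[OF q(1)]
      let ?ts = "tapes k [f (rs ! B)]"
      have "(\<lambda>t. t 0) ` set ?ts \<subseteq> {..<A}"
        using tapes_scan A by fastforce
      then have sy: "(\<lambda>t. t 0) ` set (?pre @ ?ts @ ?post) \<subseteq> {..<A}" by (rule sym)
      have "tm_step ?C (a + q, ?pre @ ?ts @ ?post) = Some (a + Q, ?pre @ ?ts @ ?post)"
        using e sy N l q(2) by (intro halt_call_table) auto
      then have "tm_steps ?C (a, ?pre @ tapes k [rs ! B] @ ?post) (a + Q, ?pre @ ?ts @ ?post)"
        using e by (meson rtranclp.rtrancl_into_rtrancl)
      then have "tm_steps ?C (a, tapes N rs) (a + Q, tapes N rs')"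
        unfolding tapes_eq[symmetric] using rs_eq rs'_eq by simp
      then show "length rs' = Suc B \<and> tm_steps ?C (a, tapes N rs) (a + Q, tapes N rs')"
        using r l by simp
    qed
  qed
qed

text \<open>A fragment entered in state 0 is a machine that halts at its exit, where it has no
  transition. Scratch registers holding 0 are blank tapes, so start and end are standard.\<close>

lemma recursive_map_program:
  assumes "program (Suc L) R" "\<And>x. R (encode x # replicate L 0) (encode (f x) # replicate L 0)"
  shows "recursive_map f"
proof -
  obtain N where "N \<ge> Suc L" "\<And>a. \<exists>c M. fragment N a c M \<and>
     (\<forall>rs rs'. length rs = Suc L \<longrightarrow> R rs rs' \<longrightarrow>
        length rs' = Suc L \<and> tm_steps M (a, tapes N rs) (c, tapes N rs'))"
    using assms(1) unfolding program_def by blast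
  then obtain c M where N: "N \<ge> Suc L" and fr: "fragment N 0 c M" and
    run: "\<And>rs rs'. length rs = Suc L \<Longrightarrow> R rs rs' \<Longrightarrow> tm_steps M (0, tapes N rs) (c, tapes N rs')"
    by blast
  have pad: "tapes N (n # replicate L 0) = standard_tapes N n" for n
    using N unfolding standard_tapes_eq tapes_def
    by (simp add: replicate_add[symmetric])
  have "tm_yields N M (encode x) (encode (f x))" for x
    unfolding tm_yields_def
  proof (intro exI[of _ c] conjI)
    show "tm_steps M (0, standard_tapes N (encode x)) (c, standard_tapes N (encode (f x)))"
      using run[OF _ assms(2)[of x]] by (simp add: pad)
    show "tm_step M (c, standard_tapes N (encode (f x))) = None"
      using fr by (fastforce simp: fragment_def split: option.splits)
  qed
  moreover have "turing_machine N M"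
    using fr N by (auto simp: turing_machine_def fragment_def)
  ultimately show ?thesis unfolding recursive_map_def by blast
qed

section \<open>Composition, pairing and iteration\<close>

text \<open>The iteration of \<open>program_while\<close> as an explicit sequence, so that a loop is
  verified by a closed formula for the registers after \<open>k\<close> rounds.\<close>

lemma program_loop:
  assumes "program L R" "i < L"
  shows "program L (\<lambda>rs rs'. \<exists>f n. f 0 = rs \<and> f n = rs' \<and> rs' ! i = 0 \<and>
    (\<forall>k<n. f k ! i \<noteq> 0 \<and> R (f k) (f (Suc k))))"
proof (rule program_weaken[OF program_while[OF assms]])
  fix rs rs'
  assume "\<exists>f n. f 0 = rs \<and> f n = rs' \<and> rs' ! i = 0 \<and> (\<forall>k<n. f k ! i \<noteq> 0 \<and> R (f k) (f (Suc k)))"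
  then obtain f n where f: "f 0 = rs" "f n = rs'" "rs' ! i = 0"
    "\<forall>k<n. f k ! i \<noteq> 0 \<and> R (f k) (f (Suc k))" by blast
  have "k \<le> n \<Longrightarrow> (\<lambda>rs rs'. rs ! i \<noteq> 0 \<and> R rs rs')\<^sup>*\<^sup>* (f 0) (f k)" for k
  proof (induction k)
    case (Suc k)
    then have step: "f k ! i \<noteq> 0 \<and> R (f k) (f (Suc k))" using f(4) by simp
    have "(\<lambda>rs rs'. rs ! i \<noteq> 0 \<and> R rs rs')\<^sup>*\<^sup>* (f 0) (f k)" using Suc by simp
    then show ?case by (rule rtranclp.rtrancl_into_rtrancl) (use step in simp)
  qed simp
  then show "(\<lambda>rs rs'. rs ! i \<noteq> 0 \<and> R rs rs')\<^sup>*\<^sup>* rs rs' \<and> rs' ! i = 0"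
    using f by auto
qed

lemma program_move:
  assumes "i < L" "j < L" "i \<noteq> j"
  shows "program L (\<lambda>rs rs'. rs' = rs[i := 0, j := rs ! j + rs ! i])"
proof (rule program_weaken[OF program_loop[OF program_seq[OF program_dec program_inc]]])
  fix rs rs' :: "nat list"
  assume "length rs = L" "rs' = rs[i := 0, j := rs ! j + rs ! i]"
  then show "\<exists>f n. f 0 = rs \<and> f n = rs' \<and> rs' ! i = 0 \<and> (\<forall>k<n. f k ! i \<noteq> 0 \<and>
      ((\<lambda>rs rs'. rs' = rs[i := rs ! i - 1]) OO (\<lambda>rs rs'. rs' = rs[j := Suc (rs ! j)])) (f k) (f (Suc k)))"
    using assms
    by (intro exI[of _ "\<lambda>k. rs[i := rs ! i - k, j := rs ! j + k]"] exI[of _ "rs ! i"])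
      (auto simp: nth_list_update relcompp_apply intro!: nth_equalityI)
qed (use assms in auto)

lemma program_clear:
  assumes "i < L"
  shows "program L (\<lambda>rs rs'. rs' = rs[i := 0])"
proof (rule program_weaken[OF program_loop[OF program_dec]])
  fix rs rs' :: "nat list"
  assume "length rs = L" "rs' = rs[i := 0]"
  then show "\<exists>f n. f 0 = rs \<and> f n = rs' \<and> rs' ! i = 0 \<and> (\<forall>k<n. f k ! i \<noteq> 0 \<and>
      f (Suc k) = (f k)[i := f k ! i - 1])"
    using assms
    by (intro exI[of _ "\<lambda>k. rs[i := rs ! i - k]"] exI[of _ "rs ! i"])
      (auto simp: nth_list_update intro!: nth_equalityI)
qed (use assms in auto)

lemma program_move2:
  assumes "i < L" "j < L" "t < L" "distinct [i, j, t]"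
  shows "program L (\<lambda>rs rs'. rs' = rs[i := 0, j := rs ! j + rs ! i, t := rs ! t + rs ! i])"
proof (rule program_weaken[OF program_loop[OF
      program_seq[OF program_dec program_seq[OF program_inc program_inc]]]])
  fix rs rs' :: "nat list"
  assume "length rs = L" "rs' = rs[i := 0, j := rs ! j + rs ! i, t := rs ! t + rs ! i]"
  then show "\<exists>f n. f 0 = rs \<and> f n = rs' \<and> rs' ! i = 0 \<and> (\<forall>k<n. f k ! i \<noteq> 0 \<and>
      ((\<lambda>rs rs'. rs' = rs[i := rs ! i - 1]) OO (\<lambda>rs rs'. rs' = rs[j := Suc (rs ! j)]) OO
       (\<lambda>rs rs'. rs' = rs[t := Suc (rs ! t)])) (f k) (f (Suc k)))"
    using assms
    by (intro exI[of _ "\<lambda>k. rs[i := rs ! i - k, j := rs ! j + k, t := rs ! t + k]"] exI[of _ "rs ! i"])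
      (auto simp: nth_list_update relcompp_apply intro!: nth_equalityI)
qed (use assms in auto)

text \<open>A counter is read by counting it down. It is therefore emptied into two registers and
  restored from the scratch register \<open>t\<close>.\<close>

lemma program_copy:
  assumes "i < L" "j < L" "t < L" "distinct [i, j, t]"
  shows "program L (\<lambda>rs rs'. rs ! t = 0 \<and> rs' = rs[j := rs ! j + rs ! i])"
proof (rule program_weaken[OF program_seq[OF program_move2[of i L j t] program_move[of t L i]]])
  fix rs rs' :: "nat list"
  assume "length rs = L" "rs ! t = 0 \<and> rs' = rs[j := rs ! j + rs ! i]"
  then show "((\<lambda>rs rs'. rs' = rs[i := 0, j := rs ! j + rs ! i, t := rs ! t + rs ! i]) OO
     (\<lambda>rs rs'. rs' = rs[t := 0, i := rs ! i + rs ! t])) rs rs'"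
    using assms by (auto simp: nth_list_update relcompp_apply intro!: nth_equalityI)
qed (use assms in auto)

lemma program_const: "program (Suc 0) (\<lambda>rs rs'. rs' = [n])"
proof (induction n)
  case 0
  show ?case
    by (rule program_weaken[OF program_clear[of 0]]) (auto simp: length_Suc_conv)
next
  case (Suc n)
  show ?case
    by (rule program_weaken[OF program_seq[OF Suc program_inc[of 0]]]) (auto simp: relcompp_apply)
qed

lemma recursive_const: "recursive_map (\<lambda>_. c)"
  by (rule recursive_map_program[OF program_const[of "encode c"]]) simp

lemma recursive_Suc: "recursive_map Suc"
  by (rule recursive_map_program[OF program_inc[of 0]]) (auto simp: encode_nat_def)

text \<open>The machine for \<open>f\<close> is specified on codes only, hence the call with domain
  \<open>range encode\<close>; injectivity recovers the argument from its code.\<close>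

lemma program_map:
  fixes f :: "'a::encodable \<Rightarrow> 'b::encodable"
  assumes "recursive_map f"
  shows "program (Suc B) (\<lambda>rs rs'. \<exists>x. rs ! B = encode x \<and> rs' = rs[B := encode (f x)])"
proof -
  obtain k M where M: "turing_machine k M" "\<And>x. tm_yields k M (encode x) (encode (f x))"
    using assms unfolding recursive_map_def by blast
  show ?thesis
  proof (rule program_weaken[OF program_call[OF M(1), of "range (encode :: 'a \<Rightarrow> nat)" "\<lambda>n. encode (f (inv encode n))"]])
    show "tm_yields k M n (encode (f (inv encode n)))" if "n \<in> range (encode :: 'a \<Rightarrow> nat)" for n
      using that M(2) by (auto simp: inv_f_f[OF inj_encode])
  qed (auto simp: inv_f_f[OF inj_encode])
qed

lemma encode_eq_iff: "encode x = encode y \<longleftrightarrow> x = y"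
  using inj_encode by (rule inj_eq)

lemma recursive_comp:
  assumes "recursive_map f" "recursive_map g"
  shows "recursive_map (\<lambda>x. f (g x))"
  by (rule recursive_map_program[OF program_seq[OF program_map[OF assms(2), of 0] program_map[OF assms(1), of 0]]])
    (auto simp: relcompp_apply encode_eq_iff)

section \<open>The Cantor pairing on counters\<close>

text \<open>Since \<open>prod_encode (m, n)\<close> is \<open>triangle (m + n) + m\<close>, the
  enumeration runs along a diagonal by raising \<open>m\<close> and lowering \<open>n\<close>, and
  after \<open>n = 0\<close> it starts the next diagonal. This turns decoding into counting.\<close>

lemma prod_decode_Suc:
  "prod_decode (Suc k) =
    (case prod_decode k of (m, n) \<Rightarrow> if n = 0 then (0, Suc m) else (Suc m, n - 1))"
proof -
  obtain m n where mn: "prod_decode k = (m, n)" by force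
  then have k: "k = prod_encode (m, n)" by (metis prod_decode_inverse)
  have "prod_encode (if n = 0 then (0, Suc m) else (Suc m, n - 1)) = Suc k"
    unfolding k by (cases n) (auto simp: prod_encode_def)
  then show ?thesis unfolding mn by (metis case_prod_conv prod_encode_inverse)
qed

text \<open>Register 0 is counted down while registers 1 and 2 walk from \<open>(0, 0)\<close>
  through the enumeration of \<open>prod_decode_Suc\<close>.\<close>

lemma program_unpair:
  assumes "3 \<le> L"
  shows "program L (\<lambda>rs rs'. rs ! 1 = 0 \<and> rs ! 2 = 0 \<and>
    rs' = rs[0 := 0, 1 := fst (prod_decode (rs ! 0)), 2 := snd (prod_decode (rs ! 0))])"
proof -
  let ?body = "(\<lambda>rs rs'. rs' = rs[0 := rs ! 0 - 1]) OO
      (\<lambda>rs rs'. if rs ! 2 = 0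
        then ((\<lambda>rs rs'. rs' = rs[1 := 0, 2 := rs ! 2 + rs ! 1]) OO (\<lambda>rs rs'. rs' = rs[2 := Suc (rs ! 2)])) rs rs'
        else ((\<lambda>rs rs'. rs' = rs[1 := Suc (rs ! 1)]) OO (\<lambda>rs rs'. rs' = rs[2 := rs ! 2 - 1])) rs rs')"
  have body: "program L ?body"
    by (intro program_seq program_if program_move program_inc program_dec) (use assms in auto)
  show ?thesis
  proof (rule program_weaken[OF program_loop[OF body, of 0]])
    show "0 < L" using assms by simp
  next
    fix rs rs' :: "nat list"
    let ?p = "\<lambda>k. prod_decode k"
    assume "length rs = L" and r: "rs ! 1 = 0 \<and> rs ! 2 = 0 \<and>
      rs' = rs[0 := 0, 1 := fst (prod_decode (rs ! 0)), 2 := snd (prod_decode (rs ! 0))]"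
    with assms obtain z x y zs where "rs = z # x # y # zs"
      by (auto simp: numeral_3_eq_3 Suc_le_length_iff)
    with r have rs: "rs = z # 0 # 0 # zs"
      "rs' = 0 # fst (prod_decode z) # snd (prod_decode z) # zs"
      by (auto simp: numeral_2_eq_2)
    have p0: "?p 0 = (0, 0)"
      using prod_encode_inverse[of "(0, 0)"] by (simp add: prod_encode_def)
    define f where "f = (\<lambda>k. (z - k) # fst (?p k) # snd (?p k) # zs)"
    have "?body (f k) (f (Suc k))" for k
    proof (cases "?p k")
      case (Pair m n)
      then show ?thesis
        unfolding f_def prod_decode_Suc by (cases n) (simp_all add: relcompp_apply numeral_2_eq_2)
    qed
    moreover have "f 0 = rs" "f z = rs'" "rs' ! 0 = 0" "\<forall>k<z. f k ! 0 \<noteq> 0"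
      by (auto simp: f_def rs p0)
    ultimately show "\<exists>f n. f 0 = rs \<and> f n = rs' \<and> rs' ! 0 = 0 \<and>
        (\<forall>k<n. f k ! 0 \<noteq> 0 \<and> ?body (f k) (f (Suc k)))"
      by blast
  qed
qed

lemma recursive_fst: "recursive_map fst"
proof (rule recursive_map_program[of 2])
  show "program (Suc 2)
    ((\<lambda>rs rs'. rs ! 1 = 0 \<and> rs ! 2 = 0 \<and>
        rs' = rs[0 := 0, 1 := fst (prod_decode (rs ! 0)), 2 := snd (prod_decode (rs ! 0))]) OO
     (\<lambda>rs rs'. rs' = rs[1 := 0, 0 := rs ! 0 + rs ! 1]) OO (\<lambda>rs rs'. rs' = rs[2 := 0]))"
    by (intro program_seq program_unpair program_move program_clear) auto
qed (simp add: relcompp_apply encode_prod_def numeral_2_eq_2)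

lemma recursive_snd: "recursive_map snd"
proof (rule recursive_map_program[of 2])
  show "program (Suc 2)
    ((\<lambda>rs rs'. rs ! 1 = 0 \<and> rs ! 2 = 0 \<and>
        rs' = rs[0 := 0, 1 := fst (prod_decode (rs ! 0)), 2 := snd (prod_decode (rs ! 0))]) OO
     (\<lambda>rs rs'. rs' = rs[2 := 0, 0 := rs ! 0 + rs ! 2]) OO (\<lambda>rs rs'. rs' = rs[1 := 0]))"
    by (intro program_seq program_unpair program_move program_clear) auto
qed (simp add: relcompp_apply encode_prod_def numeral_2_eq_2)

text \<open>First register 0 becomes \<open>m\<close> and register 3 becomes \<open>m + n\<close>.
  Then register 3 is added to register 0 and decremented until it is 0, which adds
  \<open>(m + n) + ... + 1 = triangle (m + n)\<close>.\<close>

lemma program_pair: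
  "program 4 (\<lambda>rs rs'. \<exists>m n. rs = [0, m, 0, n] \<and> rs' = [prod_encode (m, n), 0, 0, 0])"
proof (rule program_weaken[OF program_seq[OF program_move2[of 1 4 0 3]
     program_loop[OF program_seq[OF program_copy[of 3 4 0 2] program_dec[of 3]], of 3]]])
  fix rs rs' :: "nat list"
  assume "\<exists>m n. rs = [0, m, 0, n] \<and> rs' = [prod_encode (m, n), 0, 0, 0]"
  then obtain m n where rs: "rs = [0, m, 0, n]" "rs' = [prod_encode (m, n), 0, 0, 0]" by blast
  let ?f = "\<lambda>k. [m + (triangle (m + n) - triangle (m + n - k)), 0, 0, m + n - k]"
  have "((\<lambda>rs rs'. rs ! 2 = 0 \<and> rs' = rs[0 := rs ! 0 + rs ! 3]) OO (\<lambda>rs rs'. rs' = rs[3 := rs ! 3 - 1]))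
      (?f k) (?f (Suc k))" if k: "k < m + n" for k
  proof -
    have "triangle (m + n - k) = triangle (m + n - Suc k) + (m + n - k)"
      using k triangle_Suc[of "m + n - Suc k"] by (simp add: Suc_diff_Suc)
    moreover have "triangle (m + n - k) \<le> triangle (m + n)"
      unfolding triangle_def by (intro div_le_mono mult_le_mono) auto
    ultimately show ?thesis using k
      by (simp add: relcompp_apply numeral_2_eq_2 numeral_3_eq_3)
  qed
  then show "((\<lambda>rs rs'. rs' = rs[1 := 0, 0 := rs ! 0 + rs ! 1, 3 := rs ! 3 + rs ! 1]) OO
     (\<lambda>rs rs'. \<exists>f n. f 0 = rs \<and> f n = rs' \<and> rs' ! 3 = 0 \<and> (\<forall>k<n. f k ! 3 \<noteq> 0 \<and>
       ((\<lambda>rs rs'. rs ! 2 = 0 \<and> rs' = rs[0 := rs ! 0 + rs ! 3]) OO (\<lambda>rs rs'. rs' = rs[3 := rs ! 3 - 1]))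
         (f k) (f (Suc k))))) rs rs'"
    unfolding rs
    by (intro relcomppI[where b = "?f 0"] exI[of _ ?f] exI[of _ "m + n"])
      (auto simp: numeral_2_eq_2 numeral_3_eq_3 prod_encode_def)
qed auto

text \<open>Subroutines act on the last register. A copy of the argument goes there for
  \<open>f\<close>, the result is parked in register 1, and then the argument itself is moved there
  for \<open>g\<close>.\<close>

lemma recursive_Pair:
  assumes "recursive_map f" "recursive_map g"
  shows "recursive_map (\<lambda>x. (f x, g x))"
proof (rule recursive_map_program[of 3])
  show "program (Suc 3)
    ((\<lambda>rs rs'. rs ! 2 = 0 \<and> rs' = rs[3 := rs ! 3 + rs ! 0]) OO
     (\<lambda>rs rs'. \<exists>x. rs ! 3 = encode x \<and> rs' = rs[3 := encode (f x)]) OO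
     (\<lambda>rs rs'. rs' = rs[3 := 0, 1 := rs ! 1 + rs ! 3]) OO
     (\<lambda>rs rs'. rs' = rs[0 := 0, 3 := rs ! 3 + rs ! 0]) OO
     (\<lambda>rs rs'. \<exists>x. rs ! 3 = encode x \<and> rs' = rs[3 := encode (g x)]) OO
     (\<lambda>rs rs'. \<exists>m n. rs = [0, m, 0, n] \<and> rs' = [prod_encode (m, n), 0, 0, 0]))"
    using program_pair
    by (intro program_seq program_copy program_map program_move assms) auto
qed (force simp: relcompp_apply encode_prod_def numeral_2_eq_2 numeral_3_eq_3)

text \<open>A counted loop around a subroutine call; all recursion schemes below reduce to it.
  Register 1 counts and register 3 holds the value, where the call expects it.\<close>

lemma recursive_iterate:
  fixes h :: "'a::encodable \<Rightarrow> 'a"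
  assumes "recursive_map h"
  shows "recursive_map (\<lambda>(n::nat, x). (h ^^ n) x)"
proof (rule recursive_map_program[of 3])
  let ?body = "(\<lambda>rs rs'. rs' = rs[1 := rs ! 1 - 1]) OO
     (\<lambda>rs rs'. \<exists>x. rs ! 3 = encode x \<and> rs' = rs[3 := encode (h x)])"
  let ?loop = "\<lambda>rs rs'. \<exists>f n. f 0 = rs \<and> f n = rs' \<and> rs' ! 1 = 0 \<and>
     (\<forall>k<n. f k ! 1 \<noteq> 0 \<and> ?body (f k) (f (Suc k)))"
  let ?R = "(\<lambda>rs rs'. rs ! 1 = 0 \<and> rs ! 2 = 0 \<and>
    rs' = rs[0 := 0, 1 := fst (prod_decode (rs ! 0)), 2 := snd (prod_decode (rs ! 0))]) OO
     (\<lambda>rs rs'. rs' = rs[2 := 0, 3 := rs ! 3 + rs ! 2]) OO ?loop OO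
     (\<lambda>rs rs'. rs' = rs[3 := 0, 0 := rs ! 0 + rs ! 3])"
  show "program (Suc 3) ?R"
    by (intro program_seq program_unpair program_map program_move program_loop program_dec assms) auto
  fix p :: "nat \<times> 'a"
  obtain n x where p: "p = (n, x)" by force
  have "?loop [0, n, 0, encode x] [0, 0, 0, encode ((h ^^ n) x)]"
    by (intro exI[of _ "\<lambda>k. [0, n - k, 0, encode ((h ^^ k) x)]"] exI[of _ n])
      (auto simp: relcompp_apply numeral_2_eq_2 numeral_3_eq_3)
  then show "?R (encode p # replicate 3 0) (encode (case p of (n, x) \<Rightarrow> (h ^^ n) x) # replicate 3 0)"
    unfolding p
    by (intro relcomppI[where b = "[0, n, encode x, 0]"] relcomppI[where b = "[0, n, 0, encode x]"]
        relcomppI[where b = "[0, 0, 0, encode ((h ^^ n) x)]"])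
      (auto simp: encode_prod_def encode_nat_def numeral_2_eq_2 numeral_3_eq_3)
qed

section \<open>Recursive maps\<close>

lemma recursive_id: "recursive_map (\<lambda>x. x)"
  by (rule recursive_map_program[OF program_seq[OF program_inc[of 0] program_dec[of 0]]])
    (auto simp: relcompp_apply)

text \<open>A machine sees codes only, so a map that acts on codes as \<open>f\<close> does is
  computed by the same machine. \<open>i\<close> changes the type of the argument and keeps its
  code.\<close>

lemma recursive_transfer:
  assumes "recursive_map f" "\<And>x. encode (i x) = encode x" "\<And>x. encode (f (i x)) = encode (g x)"
  shows "recursive_map g"
proof -
  obtain k M where "turing_machine k M" and M: "\<And>x. tm_yields k M (encode x) (encode (f x))"
    using assms(1) unfolding recursive_map_def by blast
  moreover have "tm_yields k M (encode x) (encode (g x))" for x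
    using M[of "i x"] assms(2,3) by simp
  ultimately show ?thesis unfolding recursive_map_def by blast
qed

lemma recursive_encode: "recursive_map (encode :: 'a::encodable \<Rightarrow> nat)"
  by (rule recursive_transfer[OF recursive_id, of encode]) (auto simp: encode_nat_def)

lemmas recursive_compose = recursive_comp[OF recursive_fst] recursive_comp[OF recursive_snd]
  recursive_comp[OF recursive_Suc] recursive_comp[OF recursive_encode]

lemmas recursive_intros = recursive_id recursive_const recursive_Pair recursive_compose

lemma recursive_funpow:
  fixes h :: "'a::encodable \<Rightarrow> 'a"
  assumes "recursive_map h" "recursive_map n" "recursive_map a"
  shows "recursive_map (\<lambda>x. (h ^^ n x) (a x))"
  using recursive_comp[OF recursive_iterate recursive_Pair, OF assms] by simp

section \<open>Primitive recursion and arithmetic\<close>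

text \<open>Primitive recursion is iteration on triples of the parameter, the index of the step and
  the current value.\<close>

lemma recursive_rec_nat:
  assumes "recursive_map a" "recursive_map (\<lambda>p. h (fst p) (fst (snd p)) (snd (snd p)))" "recursive_map n"
  shows "recursive_map (\<lambda>x. rec_nat (a x) (h x) (n x))"
proof -
  let ?step = "\<lambda>p. (fst p, Suc (fst (snd p)), h (fst p) (fst (snd p)) (snd (snd p)))"
  have "recursive_map ?step"
    by (intro recursive_intros assms)
  then have "recursive_map (\<lambda>x. snd (snd ((?step ^^ n x) (x, 0, a x))))"
    by (intro recursive_intros recursive_funpow assms)
  moreover have "(?step ^^ k) (x, 0, a x) = (x, k, rec_nat (a x) (h x) k)" for k x
    by (induction k) auto
  ultimately show ?thesis by simp
qed

text \<open>A recursion whose step discards the previous value is a case distinction.\<close>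

lemma recursive_if_0:
  fixes n :: "'a::encodable \<Rightarrow> nat"
  assumes "recursive_map n" "recursive_map f" "recursive_map g"
  shows "recursive_map (\<lambda>x. if n x = 0 then f x else g x)"
proof -
  have "recursive_map (\<lambda>x. rec_nat (f x) ((\<lambda>x k r. g x) x) (n x))"
    by (intro recursive_rec_nat assms recursive_comp[OF assms(3)] recursive_intros)
  moreover have "rec_nat (f x) (\<lambda>k r. g x) (n x) = (if n x = 0 then f x else g x)" for x
    by (cases "n x") auto
  ultimately show ?thesis by simp
qed

lemma recursive_If:
  assumes "recursive_map c" "recursive_map f" "recursive_map g"
  shows "recursive_map (\<lambda>x. if c x then f x else g x)"
proof -
  have "recursive_map (\<lambda>x. if encode (c x) = 0 then g x else f x)"
    by (intro recursive_if_0 assms recursive_intros)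
  moreover have "(\<lambda>x. if encode (c x) = 0 then g x else f x) = (\<lambda>x. if c x then f x else g x)"
    by (auto simp: encode_bool_def)
  ultimately show ?thesis by simp
qed

lemma recursive_add:
  fixes f g :: "'a::encodable \<Rightarrow> nat"
  assumes "recursive_map f" "recursive_map g"
  shows "recursive_map (\<lambda>x. f x + g x)"
proof -
  have "recursive_map (\<lambda>x. rec_nat (f x) ((\<lambda>x k r. Suc r) x) (g x))"
    by (intro recursive_rec_nat assms recursive_intros)
  moreover have "rec_nat a (\<lambda>k r. Suc r) b = a + b" for a b :: nat
    by (induction b) auto
  ultimately show ?thesis by simp
qed

lemma recursive_mult:
  fixes f g :: "'a::encodable \<Rightarrow> nat"
  assumes "recursive_map f" "recursive_map g"
  shows "recursive_map (\<lambda>x. f x * g x)"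
proof -
  have "recursive_map (\<lambda>x. rec_nat 0 ((\<lambda>x k r. f x + r) x) (g x))"
    by (intro recursive_rec_nat assms recursive_add recursive_comp[OF assms(1)] recursive_intros)
  moreover have "rec_nat 0 (\<lambda>k r. a + r) b = a * b" for a b :: nat
    by (induction b) auto
  ultimately show ?thesis by simp
qed

lemma recursive_diff:
  fixes f g :: "'a::encodable \<Rightarrow> nat"
  assumes "recursive_map f" "recursive_map g"
  shows "recursive_map (\<lambda>x. f x - g x)"
proof -
  \<comment> \<open>The predecessor: the recursion returns the index of its last step, and 0 if
    there is none.\<close>
  have "recursive_map (\<lambda>x. rec_nat 0 ((\<lambda>x k r. k) x) x)"
    by (intro recursive_rec_nat recursive_intros)
  moreover have "rec_nat 0 (\<lambda>k r. k) b = b - 1" for b :: nat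
    by (cases b) auto
  ultimately have pred: "recursive_map (\<lambda>x::nat. x - 1)" by simp
  have "recursive_map (\<lambda>x. rec_nat (f x) ((\<lambda>x k r. r - 1) x) (g x))"
    by (intro recursive_rec_nat assms recursive_comp[OF pred] recursive_intros)
  moreover have "rec_nat a (\<lambda>k r. r - 1) b = a - b" for a b :: nat
    by (induction b) auto
  ultimately show ?thesis by simp
qed

lemma recursive_eq_0:
  fixes n :: "'a::encodable \<Rightarrow> nat"
  assumes "recursive_map n"
  shows "recursive_map (\<lambda>x. n x = 0)"
proof -
  have "recursive_map (\<lambda>x. if n x = 0 then True else False)"
    by (intro recursive_if_0 assms recursive_const)
  moreover have "(\<lambda>x. if n x = 0 then True else False) = (\<lambda>x. n x = 0)" by auto
  ultimately show ?thesis by simp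
qed

text \<open>Truncated subtraction vanishes in both directions exactly for equal numbers.\<close>

lemma recursive_eq:
  fixes f g :: "'a::encodable \<Rightarrow> nat"
  assumes "recursive_map f" "recursive_map g"
  shows "recursive_map (\<lambda>x. f x = g x)"
proof -
  have "recursive_map (\<lambda>x. (f x - g x) + (g x - f x) = 0)"
    by (intro recursive_eq_0 recursive_add recursive_diff assms)
  moreover have "(f x - g x) + (g x - f x) = 0 \<longleftrightarrow> f x = g x" for x by auto
  ultimately show ?thesis by simp
qed

lemma recursive_conj:
  assumes "recursive_map P" "recursive_map Q"
  shows "recursive_map (\<lambda>x. P x \<and> Q x)"
proof -
  have "recursive_map (\<lambda>x. if P x then Q x else False)"
    by (intro recursive_If assms recursive_const)
  moreover have "(if P x then Q x else False) \<longleftrightarrow> P x \<and> Q x" for x by auto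
  ultimately show ?thesis by simp
qed

text \<open>The residue is counted up and reset on reaching the divisor. With divisor 0 it is never
  reset, which agrees with \<open>a mod 0 = a\<close>.\<close>

lemma recursive_mod:
  fixes f g :: "'a::encodable \<Rightarrow> nat"
  assumes "recursive_map f" "recursive_map g"
  shows "recursive_map (\<lambda>x. f x mod g x)"
proof -
  have "recursive_map (\<lambda>x. rec_nat 0 ((\<lambda>x k r. if Suc r = g x then 0 else Suc r) x) (f x))"
    by (intro recursive_rec_nat assms recursive_If recursive_eq recursive_comp[OF assms(2)] recursive_intros)
  moreover have "rec_nat 0 (\<lambda>k r. if Suc r = b then 0 else Suc r) a = a mod b" for a b :: nat
    by (induction a) (auto simp: mod_Suc)
  ultimately show ?thesis by simp
qed

text \<open>The quotient counts the multiples of the divisor among \<open>1, ..., f x\<close>; there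
  are none for divisor 0.\<close>

lemma recursive_div:
  fixes f g :: "'a::encodable \<Rightarrow> nat"
  assumes "recursive_map f" "recursive_map g"
  shows "recursive_map (\<lambda>x. f x div g x)"
proof -
  have "recursive_map (\<lambda>x. rec_nat 0 ((\<lambda>x k r. if Suc k mod g x = 0 then Suc r else r) x) (f x))"
    by (intro recursive_rec_nat assms recursive_if_0 recursive_mod recursive_comp[OF assms(2)] recursive_intros)
  moreover have "rec_nat 0 (\<lambda>k r. if Suc k mod b = 0 then Suc r else r) a = a div b" for a b :: nat
    by (induction a) (auto simp: div_Suc)
  ultimately show ?thesis by simp
qed

text \<open>A search for the last common divisor up to \<open>g x\<close>; positivity of
  \<open>g x\<close> makes it a bound for the gcd.\<close>

lemma recursive_gcd:
  fixes f g :: "'a::encodable \<Rightarrow> nat"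
  assumes "recursive_map f" "recursive_map g" "\<And>x. g x > 0"
  shows "recursive_map (\<lambda>x. gcd (f x) (g x))"
proof -
  have rec: "recursive_map (\<lambda>x. rec_nat 0
      ((\<lambda>x k r. if f x mod Suc k = 0 \<and> g x mod Suc k = 0 then Suc k else r) x) (g x))"
    by (intro recursive_rec_nat assms recursive_If recursive_conj recursive_eq_0 recursive_mod
        recursive_comp[OF assms(1)] recursive_comp[OF assms(2)] recursive_intros)
  have eq: "rec_nat 0 (\<lambda>k r. if a mod Suc k = 0 \<and> b mod Suc k = 0 then Suc k else r) n = gcd a b"
    if "b > 0" "gcd a b \<le> n" for a b n :: nat
    using that(2)
  proof (induction n)
    case 0
    then show ?case using that(1) by simp
  next
    case (Suc n)
    have pos: "gcd a b > 0" using that(1) by simp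
    \<comment> \<open>Here \<open>gcd a b \<le> Suc n\<close> by the premise, so
      \<open>Suc n\<close> is a common divisor only if it is the greatest one: the search hits the
      gcd and nothing beyond it.\<close>
    have "Suc n dvd gcd a b \<longleftrightarrow> Suc n = gcd a b"
    proof
      assume "Suc n dvd gcd a b"
      then show "Suc n = gcd a b"
        using dvd_imp_le[OF _ pos] Suc.prems by (intro le_antisym)
    qed simp
    then have step: "a mod Suc n = 0 \<and> b mod Suc n = 0 \<longleftrightarrow> Suc n = gcd a b"
      by (simp only: dvd_eq_mod_eq_0[symmetric] gcd_greatest_iff)
    show ?case
    proof (cases "Suc n = gcd a b")
      case True
      then have "a mod Suc n = 0 \<and> b mod Suc n = 0" by (rule step[THEN iffD2])
      then show ?thesis unfolding True[symmetric] by simp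
    next
      case False
      then have "gcd a b \<le> n" using Suc.prems by simp
      with False show ?thesis by (simp only: old.nat.simps(7) step Suc.IH if_False)
    qed
  qed
  have "gcd (f x) (g x) \<le> g x" for x
    using assms(3)[of x] by (simp add: gcd_le2_nat)
  then show ?thesis
    using rec by (simp only: eq[OF assms(3)])
qed

section \<open>Lists\<close>

text \<open>The code of a non-empty list is the successor of the code of the pair of head and
  tail.\<close>

lemma recursive_Cons:
  assumes "recursive_map f" "recursive_map g"
  shows "recursive_map (\<lambda>x. f x # g x)"
proof -
  have "recursive_map (\<lambda>x. Suc (encode (f x, g x)))"
    by (intro recursive_intros assms)
  then show ?thesis
    by (rule recursive_transfer[where i = "\<lambda>x. x"]) (auto simp: encode_nat_def encode_prod_def encode_list_def)
qed

lemma recursive_hd_tl: "recursive_map (\<lambda>l. (hd l, tl l))"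
proof -
  \<comment> \<open>\<open>hd []\<close> is an unspecified but fixed value, so the code for the
    empty list can be supplied as a constant.\<close>
  let ?c = "encode (hd [] :: 'a, tl [] :: 'a list)"
  have "recursive_map (\<lambda>l::'a list. if encode l = 0 then ?c else encode l - 1)"
    by (intro recursive_if_0 recursive_diff recursive_intros)
  then show ?thesis
  proof (rule recursive_transfer[where i = "\<lambda>x. x"])
    show "encode (if encode l = 0 then ?c else encode l - 1) = encode (hd l, tl l)" for l :: "'a list"
      by (cases l) (auto simp: encode_nat_def encode_prod_def encode_list_def)
  qed simp
qed

lemma recursive_hd: "recursive_map f \<Longrightarrow> recursive_map (\<lambda>x. hd (f x))"
  using recursive_comp[OF recursive_fst recursive_comp[OF recursive_hd_tl]] by force

lemma recursive_tl: "recursive_map f \<Longrightarrow> recursive_map (\<lambda>x. tl (f x))"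
  using recursive_comp[OF recursive_snd recursive_comp[OF recursive_hd_tl]] by force

text \<open>Lets the code of a list serve as the number of rounds in a loop over its
  entries.\<close>

lemma length_le_encode: "length l \<le> encode l"
  unfolding encode_list_def
  by (induction l) (auto intro: order_trans[OF _ le_prod_encode_2])

lemma recursive_fold:
  assumes "recursive_map h" "recursive_map l" "recursive_map a"
  shows "recursive_map (\<lambda>x. fold (\<lambda>y r. h (y, r)) (l x) (a x))"
proof -
  \<comment> \<open>The step consumes the head and is idle on the empty list, whose code is 0.
    Running it \<open>encode (l x)\<close> times, at least as often as there are entries, therefore
    gives the full fold.\<close>
  let ?step = "\<lambda>p. if encode (fst p) = 0 then p else (tl (fst p), h (hd (fst p), snd p))"
  have "recursive_map ?step"
    by (intro recursive_if_0 recursive_comp[OF assms(1)] recursive_hd recursive_tl recursive_intros)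
  then have "recursive_map (\<lambda>x. snd ((?step ^^ encode (l x)) (l x, a x)))"
    by (intro recursive_funpow recursive_intros assms)
  moreover have "(?step ^^ n) (l, r) = (drop n l, fold (\<lambda>y r. h (y, r)) (take n l) r)" for n l r
  proof (induction n)
    case (Suc n)
    then show ?case
      by (cases "n < length l")
        (auto simp: take_Suc_conv_app_nth hd_drop_conv_nth drop_Suc tl_drop encode_list_def
          simp flip: list_encode.simps(1) simp: list_encode_eq)
  qed simp
  ultimately show ?thesis by (simp add: length_le_encode)
qed

lemma recursive_rev:
  assumes "recursive_map f"
  shows "recursive_map (\<lambda>x. rev (f x))"
proof -
  have "recursive_map (\<lambda>x. fold (\<lambda>y r. (\<lambda>p. fst p # snd p) (y, r)) (f x) [])"
    by (intro recursive_fold recursive_Cons recursive_intros assms)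
  then show ?thesis by (simp add: fold_Cons_rev)
qed

section \<open>Rational numbers\<close>

text \<open>A rational is coded by its reduced fraction, so a computed fraction has to be cancelled
  by the gcd before its code is known.\<close>

lemma quotient_of_nat_divide:
  assumes "Q > 0"
  shows "quotient_of (of_nat P / of_nat Q) = (int (P div gcd P Q), int (Q div gcd P Q))"
proof -
  have "quotient_of (Fract (int P) (int Q)) = Rat.normalize (int P, int Q)"
    by (rule quotient_of_Fract)
  moreover have "Fract (int P) (int Q) = of_nat P / of_nat Q"
    by (simp add: Fract_of_int_quotient)
  ultimately show ?thesis using assms
    by (simp add: Rat.normalize_def Let_def zdiv_int gcd_int_int_eq)
qed

lemma encode_int_nat: "encode (int n) = 2 * n"
  by (simp add: encode_int_def int_encode_def sum_encode_def)

lemma recursive_nat_divide: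
  assumes "recursive_map f" "recursive_map g" "\<And>x. g x > (0::nat)"
  shows "recursive_map (\<lambda>x. of_nat (f x) / of_nat (g x) :: rat)"
proof -
  \<comment> \<open>The factors 2 turn natural numbers into codes of integers, by
    \<open>encode_int_nat\<close>.\<close>
  have "recursive_map (\<lambda>x. (2 * (f x div gcd (f x) (g x)), 2 * (g x div gcd (f x) (g x))))"
    by (intro recursive_intros recursive_mult recursive_div recursive_gcd assms)
  then show ?thesis
    by (rule recursive_transfer[where i = "\<lambda>x. x"])
      (auto simp: encode_rat_def quotient_of_nat_divide assms(3) encode_prod_def encode_int_nat encode_nat_def)
qed

section \<open>Betting on the selected rounds\<close>

text \<open>The state carries the reversed past, so that \<open>S\<close> can be consulted, together with
  numerator and denominator of the capital.\<close>

definition betting_step :: "(situation \<times> rforecast \<Rightarrow> bool) \<Rightarrow> (rforecast \<times> bool \<Rightarrow> nat) \<Rightarrow>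
    (rforecast \<times> bool \<Rightarrow> nat) \<Rightarrow> rforecast \<times> bool \<Rightarrow>
    situation \<times> nat \<times> nat \<Rightarrow> situation \<times> nat \<times> nat" where
  "betting_step S a b y r = (y # fst r,
     if S (rev (fst r), fst y) then (fst (snd r) * a y, snd (snd r) * b y) else snd r)"

definition betting_state :: "(situation \<times> rforecast \<Rightarrow> bool) \<Rightarrow> (rforecast \<times> bool \<Rightarrow> nat) \<Rightarrow>
    (rforecast \<times> bool \<Rightarrow> nat) \<Rightarrow> situation \<Rightarrow> situation \<times> nat \<times> nat" where
  "betting_state S a b v = fold (betting_step S a b) v ([], 1, 1)"

definition capital :: "(situation \<times> rforecast \<Rightarrow> bool) \<Rightarrow> (rforecast \<times> bool \<Rightarrow> nat) \<Rightarrow>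
    (rforecast \<times> bool \<Rightarrow> nat) \<Rightarrow> situation \<Rightarrow> rat" where
  "capital S a b v = of_nat (fst (snd (betting_state S a b v))) / of_nat (snd (snd (betting_state S a b v)))"

lemma betting_state_snoc:
  "betting_state S a b (v @ [y]) = betting_step S a b y (betting_state S a b v)"
  by (simp add: betting_state_def)

lemma fst_betting_state: "fst (betting_state S a b v) = rev v"
  by (induction v rule: rev_induct) (simp_all add: betting_state_snoc betting_step_def, simp add: betting_state_def)

lemma capital_Nil: "capital S a b [] = 1"
  by (simp add: capital_def betting_state_def)

text \<open>The growth of the capital is read off from this recursion; the accumulating fold serves
  computability.\<close>

lemma capital_snoc:
  "capital S a b (v @ [y]) =
    capital S a b v * (if S (v, fst y) then of_nat (a y) / of_nat (b y) else 1)"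
  by (simp add: capital_def betting_state_snoc betting_step_def fst_betting_state)

lemma recursive_capital:
  assumes "recursive_map S" "recursive_map a" "recursive_map b" "\<And>y. b y > 0"
  shows "recursive_map (capital S a b)"
proof -
  have "recursive_map (\<lambda>p. betting_step S a b (fst p) (snd p))"
    unfolding betting_step_def
    by (intro recursive_Pair recursive_Cons recursive_If recursive_mult recursive_rev
        recursive_comp[OF assms(1)] recursive_comp[OF assms(2)] recursive_comp[OF assms(3)] recursive_intros)
  then have "recursive_map (\<lambda>v. fold (\<lambda>y r. (\<lambda>p. betting_step S a b (fst p) (snd p)) (y, r)) v ([], 1, 1))"
    by (intro recursive_fold recursive_intros)
  then have state: "recursive_map (betting_state S a b)"
    by (simp add: betting_state_def[abs_def])
  have "snd (snd (betting_state S a b v)) > 0" for v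
    by (induction v rule: rev_induct)
      (auto simp: betting_state_snoc betting_step_def assms(4), simp add: betting_state_def)
  then show ?thesis unfolding capital_def[abs_def]
    by (intro recursive_nat_divide recursive_intros state) auto
qed

text \<open>Whether to bet depends on \<open>v\<close> and \<open>I\<close> only, not on the coming
  outcome. For each \<open>p\<close> in the forecast the expected factor is thus 1 or the one
  bounded in \<open>fair\<close>, and it is scaled by a capital that is non-negative.\<close>

lemma test_superfarthingale_capital:
  fixes S :: "situation \<times> rforecast \<Rightarrow> bool"
  assumes fair: "\<And>I p. p \<in> interval_of I \<Longrightarrow>
    p * (real (a (I, True)) / real (b (I, True))) + (1 - p) * (real (a (I, False)) / real (b (I, False))) \<le> 1"
  shows "test_superfarthingale (\<lambda>v. real_of_rat (capital S a b v))"
  unfolding test_superfarthingale_def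
proof (intro conjI allI)
  fix v :: situation and I
  show nonneg: "0 \<le> real_of_rat (capital S a b v)" for v
    by (simp add: capital_def of_rat_divide)
  let ?K = "real_of_rat (capital S a b v)"
  let ?w = "\<lambda>x. if S (v, I) then real (a (I, x)) / real (b (I, x)) else 1"
  have K: "real_of_rat (capital S a b (v @ [(I, x)])) = ?K * ?w x" for x
    by (simp add: capital_snoc of_rat_mult of_rat_divide)
  have "min_of I \<le> max_of I"
    using Rep_rforecast[of I] by (auto simp: min_of_def max_of_def of_rat_less_eq)
  then have "interval_of I \<noteq> {}" by (auto simp: interval_of_def)
  then show "upper_expectation (interval_of I) (\<lambda>x. real_of_rat (capital S a b (v @ [(I, x)]))) \<le> ?K"
    unfolding upper_expectation_def
  proof (rule cSUP_least)
    fix p assume p: "p \<in> interval_of I"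
    have "p * ?w True + (1 - p) * ?w False \<le> 1"
      using fair[OF p] by simp
    then have "?K * (p * ?w True + (1 - p) * ?w False) \<le> ?K"
      using nonneg[of v] mult_left_mono by fastforce
    then show "p * real_of_rat (capital S a b (v @ [(I, True)])) +
        (1 - p) * real_of_rat (capital S a b (v @ [(I, False)])) \<le> ?K"
      unfolding K by (simp add: algebra_simps)
  qed
qed (simp add: capital_Nil)

section \<open>Capital along a game-random path\<close>

text \<open>The values are rational and computed exactly, so the approximation can ignore its
  index.\<close>

lemma lower_semicomputable_recursive:
  assumes "recursive_map f"
  shows "lower_semicomputable (\<lambda>x. real_of_rat (f x))"
  unfolding lower_semicomputable_def
  by (intro exI[of _ "\<lambda>p. f (fst p)"]) (simp add: recursive_comp[OF assms recursive_fst])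

lemma game_random_capital_bounded:
  assumes "game_random \<upsilon>" "recursive_map S" "recursive_map a" "recursive_map b" "\<And>y. b y > 0"
    and "\<And>I p. p \<in> interval_of I \<Longrightarrow>
    p * (real (a (I, True)) / real (b (I, True))) + (1 - p) * (real (a (I, False)) / real (b (I, False))) \<le> 1"
  shows "\<exists>C. \<forall>\<^sub>F n in sequentially. real_of_rat (capital S a b (initial_segment \<upsilon> n)) < C"
proof -
  let ?F = "\<lambda>n. ereal (real_of_rat (capital S a b (initial_segment \<upsilon> n)))"
  have "limsup ?F < \<infinity>"
    using assms(1) test_superfarthingale_capital[OF assms(6)]
      lower_semicomputable_recursive[OF recursive_capital[OF assms(2-5)]]
    unfolding game_random_def by blast
  then obtain C :: nat where "limsup ?F < ereal (real C)"
    by (auto simp: less_PInf_Ex_of_nat)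
  then have "\<forall>\<^sub>F n in sequentially. ?F n < ereal C"
    by (rule Limsup_lessD)
  then show ?thesis by (auto simp del: of_rat_less)
qed

text \<open>The logarithm turns the product into a sum, to which
  \<open>ln (1 + t) \<ge> t - 2 * t^2\<close> is applied with \<open>t = g y / m\<close>. As
  \<open>\<bar>g y\<bar> \<le> 1\<close> and \<open>m \<ge> 2\<close>, this \<open>t\<close> is
  within the range of the estimate, and the quadratic loss is at most \<open>2 / m^2\<close> per
  selected round.\<close>

lemma ln_capital:
  assumes "\<And>y. real (a y) / real (b y) = 1 + g y / m" "\<And>y. \<bar>g y\<bar> \<le> 1" "m \<ge> 2"
  shows "real_of_rat (capital S a b (initial_segment \<upsilon> n)) > 0"
    and "(\<Sum>k<n. of_bool (S (initial_segment \<upsilon> k, forecast \<upsilon> k)) * g (\<upsilon> k)) / m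
       - 2 * (\<Sum>k<n. of_bool (S (initial_segment \<upsilon> k, forecast \<upsilon> k))) / m\<^sup>2
      \<le> ln (real_of_rat (capital S a b (initial_segment \<upsilon> n)))" (is "?L n \<le> _")
proof -
  have g: "\<bar>g y / m\<bar> \<le> 1/2" for y
    using assms(2)[of y] assms(3) by (simp add: abs_divide divide_le_eq)
  have "real_of_rat (capital S a b (initial_segment \<upsilon> n)) > 0 \<and>
    ?L n \<le> ln (real_of_rat (capital S a b (initial_segment \<upsilon> n)))"
  proof (induction n)
    case 0
    show ?case by (simp add: initial_segment_def capital_Nil)
  next
    case (Suc n)
    let ?K = "real_of_rat (capital S a b (initial_segment \<upsilon> n))"
    let ?s = "S (initial_segment \<upsilon> n, forecast \<upsilon> n)"
    let ?w = "if ?s then 1 + g (\<upsilon> n) / m else 1"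
    have "initial_segment \<upsilon> (Suc n) = initial_segment \<upsilon> n @ [\<upsilon> n]"
      by (simp add: initial_segment_def)
    then have K: "real_of_rat (capital S a b (initial_segment \<upsilon> (Suc n))) = ?K * ?w"
      by (simp add: capital_snoc of_rat_mult of_rat_divide forecast_def flip: assms(1))
    have "g (\<upsilon> n) / m \<ge> - 1/2" using g[of "\<upsilon> n"] by linarith
    then have w: "?w > 0" by simp
    have "(g (\<upsilon> n))\<^sup>2 \<le> 1" using assms(2)[of "\<upsilon> n"] by (simp add: abs_square_le_1)
    then have "(g (\<upsilon> n) / m)\<^sup>2 \<le> 1 / m\<^sup>2"
      by (simp add: power_divide divide_right_mono)
    moreover have "g (\<upsilon> n) / m - 2 * (g (\<upsilon> n) / m)\<^sup>2 \<le> ln (1 + g (\<upsilon> n) / m)"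
      using abs_ln_one_plus_x_minus_x_bound[OF g[of "\<upsilon> n"]] by linarith
    ultimately have "of_bool ?s * g (\<upsilon> n) / m - 2 * of_bool ?s / m\<^sup>2 \<le> ln ?w" by simp
    moreover have "ln (?K * ?w) = ln ?K + ln ?w" using w Suc by (intro ln_mult_pos) auto
    ultimately have "?L (Suc n) \<le> ln (?K * ?w)"
      using Suc by (simp add: add_divide_distrib)
    then show ?case unfolding K using w Suc by simp
  qed
  then show "real_of_rat (capital S a b (initial_segment \<upsilon> n)) > 0"
    "?L n \<le> ln (real_of_rat (capital S a b (initial_segment \<upsilon> n)))" by auto
qed

text \<open>The common form of both claims, for a gain \<open>g\<close> of non-positive expectation.
  With \<open>G\<close> the selected gains and \<open>N\<close> the selected rounds, a capital below
  \<open>C\<close> gives \<open>G / m - 2 * N / m^2 \<le> ln C\<close>. As \<open>N\<close>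
  diverges, the average is eventually at most \<open>3 / m\<close>. The premise \<open>ab\<close>
  supplies the factors \<open>1 + g y / m\<close> as recursive fractions.\<close>

lemma limsup_average_le_0:
  fixes g :: "rforecast \<times> bool \<Rightarrow> real" and S :: "situation \<times> rforecast \<Rightarrow> bool"
  defines "s \<equiv> \<lambda>\<upsilon> k. of_bool (S (initial_segment \<upsilon> k, forecast \<upsilon> k)) :: real"
  assumes "recursive_map S" and div: "filterlim (\<lambda>n. \<Sum>k<n. s \<upsilon> k) at_top sequentially"
    and "game_random \<upsilon>"
    and g: "\<And>y. \<bar>g y\<bar> \<le> 1"
    and fair: "\<And>I p. p \<in> interval_of I \<Longrightarrow> p * g (I, True) + (1 - p) * g (I, False) \<le> 0"
    and ab: "\<And>m::nat. m \<ge> 2 \<Longrightarrow> \<exists>a b. recursive_map a \<and> recursive_map b \<and>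
      (\<forall>y. b y > 0 \<and> real (a y) / real (b y) = 1 + g y / real m)"
  shows "limsup (\<lambda>n. ereal ((\<Sum>k<n. s \<upsilon> k * g (\<upsilon> k)) / (\<Sum>k<n. s \<upsilon> k))) \<le> 0"
proof -
  let ?N = "\<lambda>n. \<Sum>k<n. s \<upsilon> k"
  let ?G = "\<lambda>n. \<Sum>k<n. s \<upsilon> k * g (\<upsilon> k)"
  have bound: "limsup (\<lambda>n. ereal (?G n / ?N n)) \<le> ereal (3 / real m)" if m: "m \<ge> 2" for m :: nat
  proof -
    obtain a b where ab: "recursive_map a" "recursive_map b" "\<And>y. b y > 0"
      "\<And>y. real (a y) / real (b y) = 1 + g y / real m"
      using ab[OF m] by blast
    have "p * (real (a (I, True)) / real (b (I, True))) + (1 - p) * (real (a (I, False)) / real (b (I, False))) \<le> 1"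
      if "p \<in> interval_of I" for p I
    proof -
      have "(p * g (I, True) + (1 - p) * g (I, False)) / real m \<le> 0"
        using fair[OF that] by (simp add: divide_nonpos_nonneg)
      then show ?thesis unfolding ab(4) by (simp add: algebra_simps add_divide_distrib diff_divide_distrib)
    qed
    from game_random_capital_bounded[OF assms(4,2) ab(1-3) this] obtain C where
      C: "\<forall>\<^sub>F n in sequentially. real_of_rat (capital S a b (initial_segment \<upsilon> n)) < C"
      by blast
    \<comment> \<open>Beyond \<open>m^2 * ln C\<close> the term \<open>m * ln C\<close> is at most
      \<open>N / m\<close>, which turns the loss \<open>2 / m\<close> into \<open>3 / m\<close>; the
      maximum with 0 makes \<open>N\<close> positive for the division.\<close>
    have "\<forall>\<^sub>F n in sequentially. ?N n > max 0 (real m * (real m * ln C))"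
      using div unfolding filterlim_at_top_dense by blast
    with C have "\<forall>\<^sub>F n in sequentially. ?G n / ?N n \<le> 3 / real m"
    proof eventually_elim
      case (elim n)
      note ln = ln_capital[of a b g "real m", OF ab(4) g, of S \<upsilon> n]
      have m2: "real m \<ge> 2" using m by simp
      have "ln (real_of_rat (capital S a b (initial_segment \<upsilon> n))) \<le> ln C"
        using elim(1) ln(1)[OF m2] by (intro ln_mono) linarith+
      then have "?G n / real m - 2 * ?N n / (real m)\<^sup>2 \<le> ln C"
        using ln(2)[OF m2] unfolding s_def by linarith
      then have "real m * (?G n / real m - 2 * ?N n / (real m)\<^sup>2) \<le> real m * ln C"
        using m by (intro mult_left_mono) auto
      then have "?G n - 2 * ?N n / real m \<le> real m * ln C"
        using m by (simp add: right_diff_distrib power2_eq_square)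
      also have "real m * ln C \<le> ?N n / real m"
        using elim(2) m by (simp add: le_divide_eq mult.commute)
      finally have "?G n \<le> 3 / real m * ?N n" by simp
      then show ?case using elim(2) by (simp add: divide_le_eq)
    qed
    then show ?thesis by (intro Limsup_bounded) (auto elim: eventually_mono)
  qed
  show ?thesis
  proof (rule ereal_le_epsilon2)
    fix e :: real assume "0 < e"
    then obtain m :: nat where "max 2 (3 / e) < real m" using reals_Archimedean2 by blast
    then have m: "m \<ge> 2" "3 / real m \<le> e" using \<open>0 < e\<close> by (auto simp: field_simps)
    show "limsup (\<lambda>n. ereal (?G n / ?N n)) \<le> 0 + ereal e"
      using bound[OF m(1)] m(2) by (auto intro: order_trans)
  qed
qed

section \<open>Interval endpoints as fractions of natural numbers\<close>

text \<open>Halving a code inverts \<open>encode_int_nat\<close>, so for the non-negative rationals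
  used here \<open>num_of\<close> and \<open>den_of\<close> give the reduced fraction in natural
  numbers by arithmetic on codes.\<close>

definition num_of :: "rat \<Rightarrow> nat" where
  "num_of r = encode (fst (quotient_of r)) div 2"

definition den_of :: "rat \<Rightarrow> nat" where
  "den_of r = encode (snd (quotient_of r)) div 2"

lemma recursive_num_of: "recursive_map f \<Longrightarrow> recursive_map (\<lambda>x. num_of (f x))"
  and recursive_den_of: "recursive_map f \<Longrightarrow> recursive_map (\<lambda>x. den_of (f x))"
proof -
  have q: "recursive_map quotient_of"
    by (rule recursive_transfer[OF recursive_id, of quotient_of]) (auto simp: encode_rat_def)
  show "recursive_map (\<lambda>x. num_of (f x))" "recursive_map (\<lambda>x. den_of (f x))" if "recursive_map f"
    unfolding num_of_def den_of_def
    by (intro recursive_div recursive_intros recursive_comp[OF q that])+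
qed

lemma num_of_den_of:
  assumes "0 \<le> r" "r \<le> 1"
  shows "den_of r > 0" "num_of r \<le> den_of r" "real_of_rat r = real (num_of r) / real (den_of r)"
proof -
  obtain p q where q: "quotient_of r = (p, q)" by force
  note r = quotient_of_div[OF q] and pos = quotient_of_denom_pos[OF q]
  have "0 \<le> p" "p \<le> q" using assms r pos by (auto simp: zero_le_divide_iff divide_le_eq)
  then obtain m n where mn: "p = int m" "q = int n"
    using pos by (metis nonneg_int_cases less_imp_le)
  then have "num_of r = m" "den_of r = n"
    by (simp_all add: num_of_def den_of_def q encode_int_nat)
  then show "den_of r > 0" "num_of r \<le> den_of r" "real_of_rat r = real (num_of r) / real (den_of r)"
    using pos \<open>p \<le> q\<close> r mn by (auto simp: of_rat_divide)
qed

lemma recursive_Rep_rforecast: "recursive_map Rep_rforecast"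
  by (rule recursive_transfer[OF recursive_id, of Rep_rforecast]) (auto simp: encode_rforecast_def)

lemma endpoints: "0 \<le> fst (Rep_rforecast I)" "fst (Rep_rforecast I) \<le> 1"
  "0 \<le> snd (Rep_rforecast I)" "snd (Rep_rforecast I) \<le> 1"
  using Rep_rforecast[of I] by auto

lemma min_max_bounds: "0 \<le> min_of I" "min_of I \<le> 1" "0 \<le> max_of I" "max_of I \<le> 1"
  using endpoints[of I] by (auto simp: min_of_def max_of_def)

theorem theorem11:
  fixes \<upsilon> :: path and S :: "situation \<times> rforecast \<Rightarrow> bool"
  assumes "recursive_map S"
    and "filterlim (\<lambda>n. \<Sum>k<n. of_bool (S (initial_segment \<upsilon> k, forecast \<upsilon> k)) :: real)
           at_top sequentially"
    and "game_random \<upsilon>"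
  shows "0 \<le> liminf (\<lambda>n. ereal
            ((\<Sum>k<n. of_bool (S (initial_segment \<upsilon> k, forecast \<upsilon> k)) *
                 (of_bool (outcome \<upsilon> k) - min_of (forecast \<upsilon> k))) /
             (\<Sum>k<n. of_bool (S (initial_segment \<upsilon> k, forecast \<upsilon> k))))) \<and>
         limsup (\<lambda>n. ereal
            ((\<Sum>k<n. of_bool (S (initial_segment \<upsilon> k, forecast \<upsilon> k)) *
                 (of_bool (outcome \<upsilon> k) - max_of (forecast \<upsilon> k))) /
             (\<Sum>k<n. of_bool (S (initial_segment \<upsilon> k, forecast \<upsilon> k))))) \<le> 0"
proof -
  let ?s = "\<lambda>k. of_bool (S (initial_segment \<upsilon> k, forecast \<upsilon> k)) :: real"
  let ?up = "\<lambda>y :: rforecast \<times> bool. of_bool (snd y) - max_of (fst y)"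
  let ?lo = "\<lambda>y :: rforecast \<times> bool. min_of (fst y) - of_bool (snd y)"
  have "recursive_map (\<lambda>y :: rforecast \<times> bool. encode (snd y))"
    by (intro recursive_intros)
  then have outcome_nat: "recursive_map (\<lambda>y :: rforecast \<times> bool. of_bool (snd y) :: nat)"
    by (simp add: encode_bool_def)
  have bounds: "\<bar>?up y\<bar> \<le> 1" "\<bar>?lo y\<bar> \<le> 1" for y
    using min_max_bounds[of "fst y"] by auto
  \<comment> \<open>The expectations are \<open>p - max_of I\<close> and
    \<open>min_of I - p\<close>.\<close>
  have fair: "p * ?up (I, True) + (1 - p) * ?up (I, False) \<le> 0"
    "p * ?lo (I, True) + (1 - p) * ?lo (I, False) \<le> 0" if "p \<in> interval_of I" for p I
    using that by (auto simp: interval_of_def algebra_simps)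
  have up: "\<exists>a b. recursive_map a \<and> recursive_map b \<and>
      (\<forall>y. b y > 0 \<and> real (a y) / real (b y) = 1 + ?up y / real m)" if m: "m \<ge> 2" for m :: nat
  proof -
    let ?r = "\<lambda>y :: rforecast \<times> bool. snd (Rep_rforecast (fst y))"
    let ?b = "\<lambda>y. m * den_of (?r y)"
    \<comment> \<open>The factor \<open>1 + (x - num / den) / m\<close> over the common denominator
      \<open>m * den\<close>. Because the endpoint is at most 1,
      \<open>num \<le> den \<le> m * den\<close>, and the truncated subtraction is exact.\<close>
    let ?a = "\<lambda>y. m * den_of (?r y) + of_bool (snd y) * den_of (?r y) - num_of (?r y)"
    have "recursive_map ?a" "recursive_map ?b"
      by (intro recursive_mult recursive_add recursive_diff recursive_num_of recursive_den_of outcome_nat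
          recursive_comp[OF recursive_Rep_rforecast] recursive_intros)+
    moreover have "?b y > 0 \<and> real (?a y) / real (?b y) = 1 + ?up y / real m" for y
    proof -
      note r = num_of_den_of[OF endpoints(3,4)[of "fst y"]]
      have "num_of (?r y) \<le> m * den_of (?r y) + of_bool (snd y) * den_of (?r y)"
        using r(2) m by (intro trans_le_add1 order_trans[OF r(2)]) auto
      then show ?thesis using r(1) m unfolding max_of_def r(3)
        by (simp add: of_nat_diff field_simps)
    qed
    ultimately show ?thesis by blast
  qed
  have lo: "\<exists>a b. recursive_map a \<and> recursive_map b \<and>
      (\<forall>y. b y > 0 \<and> real (a y) / real (b y) = 1 + ?lo y / real m)" if m: "m \<ge> 2" for m :: nat
  proof -
    let ?r = "\<lambda>y :: rforecast \<times> bool. fst (Rep_rforecast (fst y))"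
    let ?b = "\<lambda>y. m * den_of (?r y)"
    \<comment> \<open>Likewise for \<open>1 + (num / den - x) / m\<close>; now
      \<open>x * den \<le> m * den\<close> makes the subtraction exact.\<close>
    let ?a = "\<lambda>y. m * den_of (?r y) + num_of (?r y) - of_bool (snd y) * den_of (?r y)"
    have "recursive_map ?a" "recursive_map ?b"
      by (intro recursive_mult recursive_add recursive_diff recursive_num_of recursive_den_of outcome_nat
          recursive_comp[OF recursive_Rep_rforecast] recursive_intros)+
    moreover have "?b y > 0 \<and> real (?a y) / real (?b y) = 1 + ?lo y / real m" for y
    proof -
      note r = num_of_den_of[OF endpoints(1,2)[of "fst y"]]
      have "of_bool (snd y) * den_of (?r y) \<le> m * den_of (?r y) + num_of (?r y)"
        using m by (intro trans_le_add1 mult_le_mono1) auto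
      then show ?thesis using r(1) m unfolding min_of_def r(3)
        by (simp add: of_nat_diff field_simps)
    qed
    ultimately show ?thesis by blast
  qed
  have "limsup (\<lambda>n. ereal ((\<Sum>k<n. ?s k * ?up (\<upsilon> k)) / (\<Sum>k<n. ?s k))) \<le> 0"
    by (rule limsup_average_le_0[OF assms bounds(1) fair(1) up])
  moreover have "limsup (\<lambda>n. ereal ((\<Sum>k<n. ?s k * ?lo (\<upsilon> k)) / (\<Sum>k<n. ?s k))) \<le> 0"
    by (rule limsup_average_le_0[OF assms bounds(2) fair(2) lo])
  \<comment> \<open>The gains at the lower endpoints are the negated terms of the claim, and the
    limsup of a negated sequence is minus its liminf.\<close>
  moreover have "(\<Sum>k<n. ?s k * ?lo (\<upsilon> k)) =
      - (\<Sum>k<n. ?s k * (of_bool (outcome \<upsilon> k) - min_of (forecast \<upsilon> k)))" for n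
    unfolding sum_negf[symmetric] by (intro sum.cong) (auto simp: outcome_def forecast_def)
  ultimately show ?thesis
    by (simp only: ereal_uminus_le_0_iff outcome_def forecast_def minus_divide_left[symmetric]
        uminus_ereal.simps(1)[symmetric] ereal_Limsup_uminus simp_thms)
qed

end
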